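(* Let $G=(V,E,L)$ be a looped simple graph and let $f:2^{E\cup L}\to\mathbb{Z}$ be given by $f(T)=2|V(T)|-3$ if $T\subseteq E$ and $f(T)=2|V(T)|$ if $T\cap L\ne\emptyset$. Then for every $T\subseteq E\cup L$, $$r^{lc}_2(T)=\min\Big\{|L'|+\sum_{i=0}^k f(T_i) : L'\subseteq T\cap L,\ \{T_0,T_1,\dots,T_k\}\text{ a partition of } T\setminus L'\Big\},$$ where the minimum is taken only over partitions in which $T_1,\dots,T_k$ contain no loops and $|V(T_i)\cap V(T_j)|\le 1$ for all distinct $i,j$.
   Context: A looped simple graph $G=(V,E,L)$ consists of a finite vertex set $V$, a set $E$ of edges forming a simple graph on $V$, and a set $L$ of loops, each incident with one vertex (multiple loops allowed). $V(T)$ is the set of vertices incident with members of $T$. Partitions consist of nonempty blocks. For $p:V\to\mathbb{R}^2$, $q:L\to\mathbb{R}^2$, the rigidity matrix $R(G,p,q)$ has two columns per vertex and one row per edge or loop: the row of an edge $uv$ has $p(u)-p(v)$ in the columns of $u$, $p(v)-p(u)$ in the columns of $v$, zeros elsewhere; the row of a loop $l$ at $v$ has $q(l)$ in the columns of $v$, zeros elsewhere. $(p,q)$ is generic if its coordinates are algebraically independent over $\mathbb{Q}$. $r^{lc}_2$ is the rank function of the generic linearly constrained rigidity matroid on $E\cup L$: $r^{lc}_2(T)$ is the rank of the rows of $R(G,p,q)$ indexed by $T$ for generic $(p,q)$. *)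

theory Defs
  imports "HOL-Analysis.Analysis" "HOL-Library.Poly_Mapping" "HOL-Library.Disjoint_Sets"
begin

(* Edges and loops are abstract elements with an incidence map, so that parallel loops are
   possible and T can range over subsets of the union of edges and loops. *)
record ('v, 'e) looped_graph =
  verts :: "'v set"
  edges :: "'e set"
  loops :: "'e set"
  ends :: "'e \<Rightarrow> 'v set"

definition looped_simple_graph :: "('v, 'e) looped_graph \<Rightarrow> bool" where
  "looped_simple_graph G \<longleftrightarrow>
     finite (verts G) \<and> finite (loops G) \<and> edges G \<inter> loops G = {} \<and>
     (\<forall>e\<in>edges G. ends G e \<subseteq> verts G \<and> card (ends G e) = 2) \<and>
     inj_on (ends G) (edges G) \<and>
     (\<forall>l\<in>loops G. ends G l \<subseteq> verts G \<and> card (ends G l) = 1)"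

definition verts_of :: "('v, 'e) looped_graph \<Rightarrow> 'e set \<Rightarrow> 'v set" where
  "verts_of G T = (\<Union>e\<in>T. ends G e)"

definition count_fun :: "('v, 'e) looped_graph \<Rightarrow> 'e set \<Rightarrow> int" where
  "count_fun G T = (if T \<inter> loops G \<noteq> {} then 2 * int (card (verts_of G T))
                    else 2 * int (card (verts_of G T)) - 3)"

(* The type real^2^'v provides two columns for each element of the finite type 'v; the columns of
   elements outside the vertex set vanish, as ends G e is contained in verts G.
   For an edge with ends {w, v}, the_elem (ends G e - {w}) is v. *)
definition rigidity_row ::
  "('v::finite, 'e) looped_graph \<Rightarrow> ('v \<Rightarrow> real^2) \<Rightarrow> ('e \<Rightarrow> real^2) \<Rightarrow> 'e \<Rightarrow> real^2^'v" where
  "rigidity_row G p q e =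
     (\<chi> w. if w \<in> ends G e
           then (if e \<in> edges G then p w - p (the_elem (ends G e - {w})) else q e)
           else 0)"

lemma rigidity_row_edge:
  assumes "e \<in> edges G" "ends G e = {u, v}" "u \<noteq> v"
  shows "rigidity_row G p q e = (\<chi> w. if w = u then p u - p v else if w = v then p v - p u else 0)"
proof -
  have "{u, v} - {u} = {v}" "{u, v} - {v} = {u}"
    using assms(3) by auto
  then show ?thesis
    using assms by (auto simp: rigidity_row_def vec_eq_iff)
qed

lemma rigidity_row_loop:
  assumes "looped_simple_graph G" "l \<in> loops G" "ends G l = {v}"
  shows "rigidity_row G p q l = (\<chi> w. if w = v then q l else 0)"
  using assms by (auto simp: rigidity_row_def vec_eq_iff looped_simple_graph_def)

definition row_rank ::
  "('v::finite, 'e) looped_graph \<Rightarrow> ('v \<Rightarrow> real^2) \<Rightarrow> ('e \<Rightarrow> real^2) \<Rightarrow> 'e set \<Rightarrow> nat" where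
  "row_rank G p q T = dim (rigidity_row G p q ` T)"

(* Polynomials over the rationals in variables of type 'i: finitely supported maps from
   exponent vectors to coefficients. *)
definition eval_mpoly :: "('i \<Rightarrow> real) \<Rightarrow> (('i \<Rightarrow>\<^sub>0 nat) \<Rightarrow>\<^sub>0 rat) \<Rightarrow> real" where
  "eval_mpoly x P =
     (\<Sum>m\<in>Poly_Mapping.keys P. of_rat (Poly_Mapping.lookup P m) *
        (\<Prod>i\<in>Poly_Mapping.keys m. x i ^ Poly_Mapping.lookup m i))"

definition algebraically_independent :: "('i \<Rightarrow> real) \<Rightarrow> 'i set \<Rightarrow> bool" where
  "algebraically_independent x I \<longleftrightarrow>
     (\<forall>P. (\<forall>m\<in>Poly_Mapping.keys P. Poly_Mapping.keys m \<subseteq> I) \<and> eval_mpoly x P = 0 \<longrightarrow> P = 0)"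

definition generic ::
  "('v, 'e) looped_graph \<Rightarrow> ('v \<Rightarrow> real^2) \<Rightarrow> ('e \<Rightarrow> real^2) \<Rightarrow> bool" where
  "generic G p q \<longleftrightarrow>
     algebraically_independent (case_sum (\<lambda>(v, i). p v $ i) (\<lambda>(l, i). q l $ i))
       ((verts G \<times> (UNIV :: 2 set)) <+> (loops G \<times> (UNIV :: 2 set)))"

(* The common value of the rank over all generic (p, q). *)
definition rank_lc :: "('v::finite, 'e) looped_graph \<Rightarrow> 'e set \<Rightarrow> nat" where
  "rank_lc G T = (THE r. \<forall>p q. generic G p q \<longrightarrow> row_rank G p q T = r)"

(* P is the set {T_0, ..., T_k}. It is empty exactly when A is empty; otherwise T_0 is the only
   block allowed (but not required) to contain loops. *)
definition admissible_partition :: "('v, 'e) looped_graph \<Rightarrow> 'e set \<Rightarrow> 'e set set \<Rightarrow> bool" where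
  "admissible_partition G A P \<longleftrightarrow>
     partition_on A P \<and>
     (P = {} \<or> (\<exists>T\<^sub>0\<in>P. \<forall>B\<in>P - {T\<^sub>0}. B \<inter> loops G = {})) \<and>
     (\<forall>B\<in>P. \<forall>C\<in>P. B \<noteq> C \<longrightarrow> card (verts_of G B \<inter> verts_of G C) \<le> 1)"

end

theory Submission imports Defs "HOL-Computational_Algebra.Polynomial"
begin

text \<open>Call a set of edges and loops sparse if every subset \<open>A\<close> has at most \<open>2|V(A)|\<close> elements, and at
  most \<open>2|V(A)| - 3\<close> if it is nonempty and loopless. Sparse sets are generically independent, by
  Henneberg induction: a sparse set has a vertex of degree at most 3. Up to degree 2 the vertex is
  deleted; in degree 3 it is replaced by one new edge or loop at its neighbours, which keeps the set
  sparse unless tight sets block every candidate, and their union would then contradict sparsity.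
  The deleted vertex is put back in a special position (on the line of the new edge, or in the
  direction of the new loop); independence there is witnessed by a polynomial that does not vanish,
  and thus carries over to all generic positions.

  For a maximal sparse \<open>J \<subseteq> T\<close>, the largest tight subset of \<open>J\<close> with \<open>|A| = 2|V(A)|\<close> and the maximal
  subsets of edges with \<open>|A| = 2|V(A)| - 3\<close> meet pairwise in at most one vertex. The elements of \<open>T\<close>
  they span are the blocks of a partition of value at most \<open>|J|\<close>, where \<open>L'\<close> consists of the loops
  outside the first one. Conversely, the value of any partition bounds the rank, because the rows of
  a loopless block are orthogonal to the three-dimensional space of trivial motions.\<close>

section \<open>Polynomial functions and algebraic independence\<close>

definition monom_value :: "('i \<Rightarrow> real) \<Rightarrow> ('i \<Rightarrow>\<^sub>0 nat) \<Rightarrow> real" where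
  "monom_value x m = (\<Prod>i\<in>Poly_Mapping.keys m. x i ^ Poly_Mapping.lookup m i)"

lemma monom_value_superset:
  assumes "finite S" "Poly_Mapping.keys m \<subseteq> S"
  shows "monom_value x m = (\<Prod>i\<in>S. x i ^ Poly_Mapping.lookup m i)"
  unfolding monom_value_def
  by (rule prod.mono_neutral_left) (use assms in \<open>auto simp: in_keys_iff\<close>)

lemma monom_value_add: "monom_value x (m + n) = monom_value x m * monom_value x n"
proof -
  let ?S = "Poly_Mapping.keys m \<union> Poly_Mapping.keys n"
  have "monom_value x k = (\<Prod>i\<in>?S. x i ^ Poly_Mapping.lookup k i)" if "k \<in> {m, n, m + n}" for k
    using that keys_add[of m n] by (intro monom_value_superset) auto
  then show ?thesis
    by (simp add: lookup_add power_add prod.distrib)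
qed

lemma monom_value_cong:
  "(\<And>i. i \<in> Poly_Mapping.keys m \<Longrightarrow> x i = y i) \<Longrightarrow> monom_value x m = monom_value y m"
  by (simp add: monom_value_def)

lemma eval_mpoly_monoms:
  "eval_mpoly x P = (\<Sum>m\<in>Poly_Mapping.keys P. of_rat (Poly_Mapping.lookup P m) * monom_value x m)"
  by (simp add: eval_mpoly_def monom_value_def)

lemma eval_mpoly_superset:
  assumes "finite S" "Poly_Mapping.keys P \<subseteq> S"
  shows "eval_mpoly x P = (\<Sum>m\<in>S. of_rat (Poly_Mapping.lookup P m) * monom_value x m)"
  unfolding eval_mpoly_monoms
  by (rule sum.mono_neutral_left) (use assms in \<open>auto simp: in_keys_iff\<close>)

lemma eval_mpoly_zero [simp]: "eval_mpoly x 0 = 0"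
  by (simp add: eval_mpoly_def)

lemma eval_mpoly_add: "eval_mpoly x (P + Q) = eval_mpoly x P + eval_mpoly x Q"
proof -
  let ?S = "Poly_Mapping.keys P \<union> Poly_Mapping.keys Q"
  have "eval_mpoly x R = (\<Sum>m\<in>?S. of_rat (Poly_Mapping.lookup R m) * monom_value x m)"
    if "R \<in> {P, Q, P + Q}" for R
    using that keys_add[of P Q] by (intro eval_mpoly_superset) auto
  then show ?thesis
    by (simp add: lookup_add of_rat_add distrib_right sum.distrib)
qed

lemma eval_mpoly_sum: "eval_mpoly x (\<Sum>k\<in>K. P k) = (\<Sum>k\<in>K. eval_mpoly x (P k))"
  by (induction K rule: infinite_finite_induct) (auto simp: eval_mpoly_add)

lemma eval_mpoly_single: "eval_mpoly x (Poly_Mapping.single m c) = of_rat c * monom_value x m"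
  by (simp add: eval_mpoly_monoms)

definition variables :: "(('i \<Rightarrow>\<^sub>0 nat) \<Rightarrow>\<^sub>0 rat) \<Rightarrow> 'i set" where
  "variables P = (\<Union>m\<in>Poly_Mapping.keys P. Poly_Mapping.keys m)"

lemma algebraically_independent_iff:
  "algebraically_independent x I \<longleftrightarrow> (\<forall>P. variables P \<subseteq> I \<and> eval_mpoly x P = 0 \<longrightarrow> P = 0)"
  by (simp add: algebraically_independent_def variables_def UN_subset_iff)

lemma variables_add: "variables (P + Q) \<subseteq> variables P \<union> variables Q"
  using keys_add[of P Q] unfolding variables_def by blast

lemma variables_sum: "variables (\<Sum>k\<in>K. P k) \<subseteq> (\<Union>k\<in>K. variables (P k))"
  using keys_sum[of P K] by (fastforce simp: variables_def)

lemma variables_single: "variables (Poly_Mapping.single m c) \<subseteq> Poly_Mapping.keys m"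
  by (simp add: variables_def)

text \<open>Rational polynomial functions, kept as functions so that membership follows from the
  introduction rules without handling exponent vectors.\<close>

inductive_set polyfun :: "'i set \<Rightarrow> (('i \<Rightarrow> real) \<Rightarrow> real) set" for I where
  const: "(\<lambda>x. of_rat c) \<in> polyfun I"
| var: "i \<in> I \<Longrightarrow> (\<lambda>x. x i) \<in> polyfun I"
| add: "F \<in> polyfun I \<Longrightarrow> G \<in> polyfun I \<Longrightarrow> (\<lambda>x. F x + G x) \<in> polyfun I"
| mult: "F \<in> polyfun I \<Longrightarrow> G \<in> polyfun I \<Longrightarrow> (\<lambda>x. F x * G x) \<in> polyfun I"

lemma polyfun_zero: "(\<lambda>x. 0) \<in> polyfun I"
  using polyfun.const[of 0 I] by simp

lemma polyfun_one: "(\<lambda>x. 1) \<in> polyfun I"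
  using polyfun.const[of 1 I] by simp

lemma polyfun_diff:
  assumes "F \<in> polyfun I" "G \<in> polyfun I"
  shows "(\<lambda>x. F x - G x) \<in> polyfun I"
proof -
  have "(\<lambda>x. F x + of_rat (-1) * G x) \<in> polyfun I"
    by (intro polyfun.intros assms)
  then show ?thesis
    by (simp add: of_rat_minus)
qed

text \<open>Links these functions to the formal polynomials in the definition of algebraic
  independence.\<close>

lemma polyfun_eval_mpoly:
  assumes "F \<in> polyfun I"
  shows "\<exists>P. variables P \<subseteq> I \<and> (\<forall>x. eval_mpoly x P = F x)"
  using assms
proof induction
  case (const c)
  show ?case
    using variables_single[of 0 c]
    by (intro exI[of _ "Poly_Mapping.single 0 c"]) (auto simp: eval_mpoly_single monom_value_def)
next
  case (var i)
  then show ?case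
    using variables_single[of "Poly_Mapping.single i 1" 1]
    by (intro exI[of _ "Poly_Mapping.single (Poly_Mapping.single i 1) 1"])
      (auto simp: eval_mpoly_single monom_value_def)
next
  case (add F G)
  then obtain P Q where P: "variables P \<subseteq> I" "\<forall>x. eval_mpoly x P = F x"
    and Q: "variables Q \<subseteq> I" "\<forall>x. eval_mpoly x Q = G x"
    by blast
  have "variables (P + Q) \<subseteq> I"
    using variables_add[of P Q] P(1) Q(1) by (meson Un_least subset_trans)
  then show ?case
    using P(2) Q(2) by (intro exI[of _ "P + Q"] conjI) (simp_all add: eval_mpoly_add)
next
  case (mult F G)
  then obtain P Q where P: "variables P \<subseteq> I" "\<forall>x. eval_mpoly x P = F x"
    and Q: "variables Q \<subseteq> I" "\<forall>x. eval_mpoly x Q = G x"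
    by blast
  \<comment> \<open>The product expanded over pairs of monomials, so that its values and its
    variables follow from the rules for sums and single monomials.\<close>
  define R where "R = (\<Sum>m\<in>Poly_Mapping.keys P. \<Sum>n\<in>Poly_Mapping.keys Q.
    Poly_Mapping.single (m + n) (Poly_Mapping.lookup P m * Poly_Mapping.lookup Q n))"
  have "eval_mpoly x R = F x * G x" for x
  proof -
    have "eval_mpoly x R = eval_mpoly x P * eval_mpoly x Q"
      unfolding eval_mpoly_monoms[of x P] eval_mpoly_monoms[of x Q] sum_product
      by (simp add: R_def eval_mpoly_sum eval_mpoly_single monom_value_add of_rat_mult mult_ac)
    with P Q show ?thesis
      by simp
  qed
  moreover have "variables R \<subseteq> I"
    unfolding R_def
  proof (intro subset_trans[OF variables_sum] UN_least)
    fix m n assume "m \<in> Poly_Mapping.keys P" "n \<in> Poly_Mapping.keys Q"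
    then have "Poly_Mapping.keys (m + n) \<subseteq> I"
      using P(1) Q(1) keys_add[of m n] unfolding variables_def UN_subset_iff
      by (meson Un_least subset_trans)
    then show "variables (Poly_Mapping.single (m + n)
        (Poly_Mapping.lookup P m * Poly_Mapping.lookup Q n)) \<subseteq> I"
      using variables_single by (rule subset_trans[rotated])
  qed
  ultimately show ?case
    by blast
qed

text \<open>The point \<open>y\<close> is arbitrary: a nonzero value anywhere shows that the
  polynomial is not zero, hence it cannot vanish at an independent point. This lets special
  positions decide about generic ones.\<close>

lemma polyfun_nonzero_transfer:
  assumes "algebraically_independent x I" "F \<in> polyfun I" "F y \<noteq> 0"
  shows "F x \<noteq> 0"
  using polyfun_eval_mpoly[OF assms(2)] assms(1,3)
  by (metis algebraically_independent_iff eval_mpoly_zero)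

section \<open>Existence of algebraically independent points\<close>

lemma countable_poly_mapping:
  fixes A :: "'a set" and C :: "'b::zero set"
  assumes "countable A" "countable C"
  shows "countable {P :: 'a \<Rightarrow>\<^sub>0 'b. Poly_Mapping.keys P \<subseteq> A \<and> Poly_Mapping.range P \<subseteq> C}"
    (is "countable ?S")
proof (rule countable_subset)
  \<comment> \<open>The graph over the support determines the map and is a finite subset of
    \<open>A \<times> C\<close>.\<close>
  let ?g = "\<lambda>P :: 'a \<Rightarrow>\<^sub>0 'b. (\<lambda>k. (k, Poly_Mapping.lookup P k)) ` Poly_Mapping.keys P"
  have inj: "inj_on ?g ?S"
  proof (rule inj_onI)
    fix P Q :: "'a \<Rightarrow>\<^sub>0 'b" assume eq: "?g P = ?g Q"
    have "Poly_Mapping.keys P = fst ` ?g P" "Poly_Mapping.keys Q = fst ` ?g Q"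
      by force+
    with eq have keys: "Poly_Mapping.keys P = Poly_Mapping.keys Q"
      by simp
    show "P = Q"
    proof (rule poly_mapping_eqI)
      fix k
      show "Poly_Mapping.lookup P k = Poly_Mapping.lookup Q k"
      proof (cases "k \<in> Poly_Mapping.keys P")
        case True
        then have "(k, Poly_Mapping.lookup P k) \<in> ?g Q"
          using eq by blast
        then show ?thesis by auto
      qed (use keys in \<open>auto simp: in_keys_iff\<close>)
    qed
  qed
  have "?g ` ?S \<subseteq> {X. finite X \<and> X \<subseteq> A \<times> C}"
    by (auto simp: subset_iff)
  moreover have "countable {X. finite X \<and> X \<subseteq> A \<times> C}"
    using assms by (intro countable_Collect_finite_subset countable_SIGMA)
  ultimately show "countable ?S"
    using countable_subset countable_image_inj_on[OF _ inj] by blast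
qed simp

text \<open>Two levels of finitely supported maps: the exponent vectors over \<open>I\<close> are
  countably many, and so are the rational coefficient maps on them.\<close>

lemma countable_mpolys:
  assumes "finite I"
  shows "countable {P. variables P \<subseteq> I}"
proof -
  have "countable {m :: 'a \<Rightarrow>\<^sub>0 nat. Poly_Mapping.keys m \<subseteq> I \<and> Poly_Mapping.range m \<subseteq> UNIV}"
    (is "countable ?M")
    using assms by (intro countable_poly_mapping) (auto simp: countable_finite)
  then have "countable {P :: ('a \<Rightarrow>\<^sub>0 nat) \<Rightarrow>\<^sub>0 rat.
      Poly_Mapping.keys P \<subseteq> ?M \<and> Poly_Mapping.range P \<subseteq> UNIV}"
    by (rule countable_poly_mapping) simp
  then show ?thesis
    by (rule countable_subset[rotated]) (auto simp: variables_def)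
qed

text \<open>Viewed as a polynomial in the new coordinate, a nonzero \<open>P\<close> has a coefficient that is
  a nonzero polynomial in the old ones.\<close>

lemma finite_bad_extension:
  assumes x: "algebraically_independent x I" and i: "i \<notin> I"
    and P: "variables P \<subseteq> insert i I" "P \<noteq> 0"
  shows "finite {t. eval_mpoly (x(i := t)) P = 0}"
proof -
  \<comment> \<open>\<open>rest\<close> removes the variable \<open>i\<close> from a monomial,
    \<open>Q k\<close> is the coefficient of the \<open>k\<close>-th power of \<open>i\<close> as a
    polynomial in the other variables, and \<open>u\<close> is the univariate polynomial left after
    evaluating those at \<open>x\<close>.\<close>
  define rest where "rest m = m - Poly_Mapping.single i (Poly_Mapping.lookup m i)"
    for m :: "'a \<Rightarrow>\<^sub>0 nat"
  have lookup_rest: "Poly_Mapping.lookup (rest m) j = (if j = i then 0 else Poly_Mapping.lookup m j)"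
    for m j
    by (auto simp: rest_def lookup_minus lookup_single when_def)
  have split: "rest m + Poly_Mapping.single i (Poly_Mapping.lookup m i) = m" for m
    by (rule poly_mapping_eqI) (auto simp: lookup_rest lookup_add lookup_single when_def)
  have keys_rest: "Poly_Mapping.keys (rest m) = Poly_Mapping.keys m - {i}" for m
    by (auto simp: in_keys_iff lookup_rest split: if_splits)
  define Q where "Q k = (\<Sum>m\<in>{m\<in>Poly_Mapping.keys P. Poly_Mapping.lookup m i = k}.
    Poly_Mapping.single (rest m) (Poly_Mapping.lookup P m))" for k
  define u where "u = (\<Sum>m\<in>Poly_Mapping.keys P.
    monom (of_rat (Poly_Mapping.lookup P m) * monom_value x (rest m)) (Poly_Mapping.lookup m i))"
  have eval_u: "poly u t = eval_mpoly (x(i := t)) P" for t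
  proof -
    have "monom_value (x(i := t)) m = monom_value x (rest m) * t ^ Poly_Mapping.lookup m i" for m
    proof -
      have "monom_value (x(i := t)) m = monom_value (x(i := t)) (rest m)
          * monom_value (x(i := t)) (Poly_Mapping.single i (Poly_Mapping.lookup m i))"
        by (metis monom_value_add split)
      moreover have "monom_value (x(i := t)) (rest m) = monom_value x (rest m)"
        by (rule monom_value_cong) (auto simp: keys_rest)
      moreover have "monom_value (x(i := t)) (Poly_Mapping.single i k) = t ^ k" for k
        by (simp add: monom_value_def)
      ultimately show ?thesis by simp
    qed
    then show ?thesis
      by (simp add: u_def poly_sum poly_monom eval_mpoly_monoms mult_ac)
  qed
  have coeff_u: "coeff u k = eval_mpoly x (Q k)" for k
    by (simp add: u_def Q_def coeff_sum eval_mpoly_sum eval_mpoly_single sum.inter_filter[symmetric]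
        if_distrib cong: if_cong)
  obtain m where m: "m \<in> Poly_Mapping.keys P"
    using P(2) by (metis all_not_in_conv keys_eq_empty)
  let ?k = "Poly_Mapping.lookup m i"
  have "Poly_Mapping.lookup (Q ?k) (rest m) = Poly_Mapping.lookup P m"
  proof -
    \<comment> \<open>A monomial is determined by \<open>rest\<close> and its exponent at
      \<open>i\<close>, so no two terms of \<open>Q ?k\<close> can merge or cancel.\<close>
    have "rest m' = rest m \<longleftrightarrow> m' = m" if "Poly_Mapping.lookup m' i = ?k" for m'
      using split[of m] split[of m'] that by metis
    then have "Poly_Mapping.lookup (Q ?k) (rest m) =
      (\<Sum>m'\<in>{m'\<in>Poly_Mapping.keys P. Poly_Mapping.lookup m' i = ?k}.
        if m' = m then Poly_Mapping.lookup P m' else 0)"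
      unfolding Q_def lookup_sum by (intro sum.cong) (auto simp: lookup_single when_def)
    also have "\<dots> = Poly_Mapping.lookup P m"
      using m by (subst sum.delta) auto
    finally show ?thesis .
  qed
  then have "Q ?k \<noteq> 0"
    using m by (metis in_keys_iff lookup_zero)
  moreover have "variables (Q ?k) \<subseteq> I"
    unfolding Q_def
  proof (intro subset_trans[OF variables_sum] UN_least)
    fix n assume "n \<in> {n\<in>Poly_Mapping.keys P. Poly_Mapping.lookup n i = ?k}"
    then have "Poly_Mapping.keys (rest n) \<subseteq> I"
      using P(1) by (auto simp: variables_def keys_rest)
    then show "variables (Poly_Mapping.single (rest n) (Poly_Mapping.lookup P n)) \<subseteq> I"
      using variables_single by (rule subset_trans[rotated])
  qed
  ultimately have "coeff u ?k \<noteq> 0"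
    using x unfolding coeff_u algebraically_independent_iff by blast
  then have "u \<noteq> 0" by auto
  then show ?thesis
    using poly_roots_finite[of u] by (simp add: eval_u)
qed

lemma algebraically_independent_exists:
  assumes "finite I"
  shows "\<exists>x. algebraically_independent x I"
  using assms
proof (induction I rule: finite_induct)
  case empty
  \<comment> \<open>Without variables only the constant monomial \<open>0\<close> can occur, so the
    value of \<open>P\<close> is its constant coefficient.\<close>
  have "P = 0" if "variables P \<subseteq> {}" "eval_mpoly (\<lambda>_. 0) P = 0" for P :: "('a \<Rightarrow>\<^sub>0 nat) \<Rightarrow>\<^sub>0 rat"
  proof -
    have keys: "Poly_Mapping.keys P \<subseteq> {0}"
      using that(1) by (auto simp: variables_def)
    then have "of_rat (Poly_Mapping.lookup P 0) = (0 :: real)"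
      using that(2) eval_mpoly_superset[of "{0}" P "\<lambda>_. 0"] by (simp add: monom_value_def)
    then show ?thesis
      using keys by (metis keys_eq_empty in_keys_iff of_rat_eq_0_iff subset_singletonD singletonI)
  qed
  then show ?case
    unfolding algebraically_independent_iff by blast
next
  case (insert i I)
  then obtain x where x: "algebraically_independent x I"
    by blast
  \<comment> \<open>Each nonzero polynomial excludes finitely many values; there are countably many
    polynomials, so the reals are not exhausted.\<close>
  let ?bad = "\<Union>P\<in>{P. variables P \<subseteq> insert i I} - {0}. {t. eval_mpoly (x(i := t)) P = 0}"
  have "countable ?bad"
    using insert.hyps by (intro countable_UN countable_Diff countable_mpolys countable_finite
      finite_bad_extension[OF x]) auto
  then obtain t where "t \<notin> ?bad"
    using uncountable_UNIV_real by (metis UNIV_eq_I)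
  then show ?case
    unfolding algebraically_independent_iff by blast
qed

section \<open>Generic linear independence\<close>

definition indep_rows :: "('j \<Rightarrow> 'c \<Rightarrow> real) \<Rightarrow> 'j set \<Rightarrow> bool" where
  "indep_rows r J \<longleftrightarrow> (\<forall>a. (\<forall>c. (\<Sum>j\<in>J. a j * r j c) = 0) \<longrightarrow> (\<forall>j\<in>J. a j = 0))"

text \<open>Fraction-free Gaussian elimination: the certificate is the product of the pivots.\<close>

lemma indep_rows_certificate:
  assumes "finite J" "\<And>j c. j \<in> J \<Longrightarrow> (\<lambda>y. r y j c) \<in> polyfun I" "indep_rows (r x) J"
  shows "\<exists>F\<in>polyfun I. F x \<noteq> 0 \<and> (\<forall>y. F y \<noteq> 0 \<longrightarrow> indep_rows (r y) J)"
  using assms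
proof (induction J arbitrary: r rule: finite_induct)
  case empty
  show ?case
    by (rule bexI[OF _ polyfun_one]) (simp add: indep_rows_def)
next
  case (insert k J)
  \<comment> \<open>Existence of a pivot: if row \<open>k\<close> were zero, the coefficient 1 on
    \<open>k\<close> alone would be a relation.\<close>
  have "\<exists>c. r x k c \<noteq> 0"
  proof (rule ccontr)
    assume "\<nexists>c. r x k c \<noteq> 0"
    then have "(\<Sum>j\<in>insert k J. of_bool (j = k) * r x j c) = 0" for c
      by (intro sum.neutral) auto
    then show False
      using insert.prems(2) unfolding indep_rows_def
      by (metis (full_types) insertI1 of_bool_eq(2) zero_neq_one)
  qed
  then obtain d where d: "r x k d \<noteq> 0" by blast
  \<comment> \<open>Clears column \<open>d\<close> by cross multiplication rather than division, so
    that the entries stay polynomial.\<close>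
  define s where "s y j c = r y k d * r y j c - r y j d * r y k c" for y j c
  have sum_s: "(\<Sum>j\<in>J. a j * s y j c)
      = r y k d * (\<Sum>j\<in>J. a j * r y j c) - (\<Sum>j\<in>J. a j * r y j d) * r y k c" for a y c
    by (simp add: s_def algebra_simps sum_subtractf sum_distrib_left sum_distrib_right)
  have "indep_rows (s x) J"
    unfolding indep_rows_def
  proof (intro allI impI)
    fix a assume a: "\<forall>c. (\<Sum>j\<in>J. a j * s x j c) = 0"
    \<comment> \<open>A relation of the reduced rows, scaled by the pivot and completed by the
      coefficient that cancels row \<open>k\<close>.\<close>
    let ?b = "\<lambda>j. if j = k then - (\<Sum>j\<in>J. a j * r x j d) else a j * r x k d"
    have "(\<Sum>j\<in>insert k J. ?b j * r x j c) = 0" for c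
    proof -
      have "(\<Sum>j\<in>J. ?b j * r x j c) = (\<Sum>j\<in>J. a j * r x k d * r x j c)"
        using insert.hyps by (intro sum.cong) auto
      also have "\<dots> = r x k d * (\<Sum>j\<in>J. a j * r x j c)"
        by (simp add: sum_distrib_left mult_ac)
      finally show ?thesis
        using insert.hyps a[rule_format, of c] unfolding sum_s by simp
    qed
    then have "\<forall>j\<in>insert k J. ?b j = 0"
      using insert.prems(2)[unfolded indep_rows_def, rule_format, of ?b] by blast
    then show "\<forall>j\<in>J. a j = 0"
      using d insert.hyps by (metis insertCI mult_eq_0_iff)
  qed
  moreover have "(\<lambda>y. s y j c) \<in> polyfun I" if "j \<in> J" for j c
    unfolding s_def using that insert.prems(1)
    by (intro polyfun_diff polyfun.mult) auto
  ultimately obtain F where F: "F \<in> polyfun I" "F x \<noteq> 0" "\<forall>y. F y \<noteq> 0 \<longrightarrow> indep_rows (s y) J"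
    using insert.IH by blast
  \<comment> \<open>Where both factors are nonzero, elimination turns a relation \<open>b\<close>
    into one of the reduced rows; then column \<open>d\<close> forces
    \<open>b k = 0\<close>.\<close>
  have "indep_rows (r y) (insert k J)" if y: "r y k d * F y \<noteq> 0" for y
    unfolding indep_rows_def
  proof (intro allI impI)
    fix b assume "\<forall>c. (\<Sum>j\<in>insert k J. b j * r y j c) = 0"
    then have b: "(\<Sum>j\<in>J. b j * r y j c) = - b k * r y k c" for c
      using insert.hyps by (simp add: add_eq_0_iff2)
    have "\<forall>c. (\<Sum>j\<in>J. b j * s y j c) = 0"
      unfolding sum_s b by simp
    then have J: "\<forall>j\<in>J. b j = 0"
      using F(3) y unfolding indep_rows_def by auto
    with b[of d] y have "b k = 0" by simp
    with J show "\<forall>j\<in>insert k J. b j = 0" by simp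
  qed
  moreover have "(\<lambda>y. r y k d * F y) \<in> polyfun I"
    using insert.prems(1) F(1) by (intro polyfun.mult) auto
  ultimately show ?case
    using F(2) d by (intro bexI[of _ "\<lambda>y. r y k d * F y"]) auto
qed

text \<open>Indexed, unlike \<open>independent\<close> for sets: two indices with the same vector
  are dependent.\<close>

definition indep_family :: "('j \<Rightarrow> 'a::real_vector) \<Rightarrow> 'j set \<Rightarrow> bool" where
  "indep_family r J \<longleftrightarrow> (\<forall>a. (\<Sum>j\<in>J. a j *\<^sub>R r j) = 0 \<longrightarrow> (\<forall>j\<in>J. a j = 0))"

lemma indep_family_iff_indep_rows:
  "indep_family r J \<longleftrightarrow> indep_rows (\<lambda>j (w, i). r j $ w $ i) J"
  for r :: "'j \<Rightarrow> real^'n^'m"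
  by (simp add: indep_family_def indep_rows_def vec_eq_iff)

text \<open>An element with one end is a loop and an element with two ends is an edge, so that replacing
  an edge by a loop only changes the incidence map.\<close>

definition lc_row :: "('e \<Rightarrow> 'v set) \<Rightarrow> ('v \<Rightarrow> real^2) \<Rightarrow> ('e \<Rightarrow> real^2) \<Rightarrow> 'e \<Rightarrow> real^2^'v::finite" where
  "lc_row En p q e = (\<chi> w. if w \<in> En e
     then (if card (En e) = 2 then p w - p (the_elem (En e - {w})) else q e) else 0)"

lemma lc_row_edge:
  assumes "En e = {u, v}" "u \<noteq> v"
  shows "lc_row En p q e $ w = (if w = u then p u - p v else if w = v then p v - p u else 0)"
proof -
  have "{u, v} - {u} = {v}" "{u, v} - {v} = {u}"
    using assms by auto
  then show ?thesis
    using assms by (simp add: lc_row_def)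
qed

lemma lc_row_loop: "En e = {v} \<Longrightarrow> lc_row En p q e $ w = (if w = v then q e else 0)"
  by (simp add: lc_row_def)

lemma lc_row_not_incident: "v \<notin> En e \<Longrightarrow> lc_row En p q e $ v = 0"
  by (simp add: lc_row_def)

text \<open>Shows that moving a vertex or changing ends elsewhere leaves the row of \<open>e\<close>
  alone.\<close>

lemma lc_row_cong:
  assumes "En e = En' e" "card (En e) \<in> {1, 2}" "\<And>w. w \<in> En e \<Longrightarrow> p w = p' w" "q e = q' e"
  shows "lc_row En p q e = lc_row En' p' q' e"
  using assms(2)
proof (elim insertE emptyE)
  assume "card (En e) = 1"
  then obtain v where "En e = {v}" by (rule card_1_singletonE)
  then show ?thesis
    using assms by (simp add: vec_eq_iff lc_row_loop)
next
  assume "card (En e) = 2"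
  then obtain u v where "En e = {u, v}" "u \<noteq> v" by (auto simp: card_2_iff)
  then show ?thesis
    using assms by (simp add: vec_eq_iff lc_row_edge)
qed

text \<open>The coordinates in the format of \<open>generic\<close>. The index set may also contain
  edges, whose value under \<open>q\<close> then serves as a spare generic direction.\<close>

definition coords :: "('v \<Rightarrow> real^2) \<Rightarrow> ('e \<Rightarrow> real^2) \<Rightarrow> ('v \<times> 2) + ('e \<times> 2) \<Rightarrow> real" where
  "coords p q = case_sum (\<lambda>(v, i). p v $ i) (\<lambda>(l, i). q l $ i)"

abbreviation coord_index :: "'v set \<Rightarrow> 'e set \<Rightarrow> (('v \<times> 2) + ('e \<times> 2)) set" where
  "coord_index V L \<equiv> (V \<times> UNIV) <+> (L \<times> UNIV)"

lemma coords_Inl [simp]: "coords p q (Inl (v, i)) = p v $ i"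
  and coords_Inr [simp]: "coords p q (Inr (l, i)) = q l $ i"
  by (simp_all add: coords_def)

lemma polyfun_lc_row:
  fixes En :: "'e \<Rightarrow> 'v::finite set"
  assumes "En e \<subseteq> V" "card (En e) \<in> {1, 2}" "card (En e) = 1 \<Longrightarrow> e \<in> L"
  shows "(\<lambda>x. lc_row En (\<lambda>v. \<chi> i. x (Inl (v, i))) (\<lambda>l. \<chi> i. x (Inr (l, i))) e $ w $ i)
    \<in> polyfun (coord_index V L)"
  using assms(2)
proof (elim insertE emptyE)
  assume "card (En e) = 1"
  moreover from this obtain v where "En e = {v}" by (rule card_1_singletonE)
  ultimately show ?thesis
    using assms by (cases "w = v") (auto simp: lc_row_loop intro!: polyfun.var polyfun_zero)
next
  assume "card (En e) = 2"
  then obtain u v where uv: "En e = {u, v}" "u \<noteq> v" by (auto simp: card_2_iff)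
  consider "w = u" | "w = v" | "w \<noteq> u \<and> w \<noteq> v" by blast
  then show ?thesis
    using assms uv
    by cases (auto simp: lc_row_edge[of En e u v] intro!: polyfun_diff polyfun.var polyfun_zero)
qed

text \<open>Passage from a special to every generic placement: the certificate of independence is a
  polynomial in the coordinates that is nonzero at \<open>(p, q)\<close>, hence nonzero at
  \<open>(p', q')\<close>.\<close>

lemma indep_family_generic:
  fixes En :: "'e \<Rightarrow> 'v::finite set"
  assumes "finite J"
    and "\<And>e. e \<in> J \<Longrightarrow> En e \<subseteq> V \<and> card (En e) \<in> {1, 2} \<and> (card (En e) = 1 \<longrightarrow> e \<in> L)"
    and "indep_family (lc_row En p q) J"
    and generic: "algebraically_independent (coords p' q') (coord_index V L)"
  shows "indep_family (lc_row En p' q') J"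
proof -
  define r where "r x = (\<lambda>e (w, i). lc_row En (\<lambda>v. \<chi> i. x (Inl (v, i)))
      (\<lambda>l. \<chi> i. x (Inr (l, i))) e $ w $ i)" for x
  have r: "indep_rows (r (coords p q)) J \<longleftrightarrow> indep_family (lc_row En p q) J" for p q
    by (simp add: r_def indep_family_iff_indep_rows)
  have "(\<lambda>x. r x e c) \<in> polyfun (coord_index V L)" if "e \<in> J" for e c
    using polyfun_lc_row[of En e V L "fst c" "snd c"] assms(2)[OF that]
    by (simp add: r_def case_prod_beta)
  with assms(1,3) obtain F where "F \<in> polyfun (coord_index V L)" "F (coords p q) \<noteq> 0"
    and F: "\<And>y. F y \<noteq> 0 \<Longrightarrow> indep_rows (r y) J"
    using indep_rows_certificate[of J r "coord_index V L" "coords p q"] r by blast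
  then have "F (coords p' q') \<noteq> 0"
    using polyfun_nonzero_transfer[OF generic] by blast
  then show ?thesis
    using F r by blast
qed

lemma generic_exists:
  assumes "finite V" "finite L"
  shows "\<exists>p q. algebraically_independent (coords p q) (coord_index V L)"
proof -
  have "finite (coord_index V L)"
    using assms by simp
  then obtain x where x: "algebraically_independent x (coord_index V L)"
    using algebraically_independent_exists by blast
  \<comment> \<open>Every coordinate vector comes from a placement.\<close>
  have "coords (\<lambda>v. \<chi> i. x (Inl (v, i))) (\<lambda>l. \<chi> i. x (Inr (l, i))) = x"
    by (auto simp: coords_def split: sum.split)
  with x show ?thesis
    by metis
qed

section \<open>Nondegenerate directions in generic placements\<close>

definition cross2 :: "real^2 \<Rightarrow> real^2 \<Rightarrow> real" where
  "cross2 a b = a $ 1 * b $ 2 - a $ 2 * b $ 1"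

lemma cross2_independent:
  assumes "cross2 a b \<noteq> 0" "s *\<^sub>R a + t *\<^sub>R b = 0"
  shows "s = 0 \<and> t = 0"
proof -
  have "s * a $ 1 + t * b $ 1 = 0" "s * a $ 2 + t * b $ 2 = 0"
    using assms(2) by (simp_all add: vec_eq_iff)
  then have "s * cross2 a b = 0" "t * cross2 a b = 0"
    unfolding cross2_def by algebra+
  with assms(1) show ?thesis by simp
qed

text \<open>A single test point \<open>y\<close> with nonzero determinant suffices; the next three
  lemmas each supply one.\<close>

lemma generic_cross2_nonzero:
  assumes "algebraically_independent (coords p q) (coord_index V L)"
    and "\<And>i. (\<lambda>x. f x i) \<in> polyfun (coord_index V L)"
    and "\<And>i. (\<lambda>x. g x i) \<in> polyfun (coord_index V L)"
    and "f y 1 * g y 2 - f y 2 * g y 1 \<noteq> 0"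
  shows "cross2 (\<chi> i. f (coords p q) i) (\<chi> i. g (coords p q) i) \<noteq> 0"
proof -
  have "(\<lambda>x. f x 1 * g x 2 - f x 2 * g x 1) \<in> polyfun (coord_index V L)"
    by (intro polyfun_diff polyfun.mult assms(2,3))
  from polyfun_nonzero_transfer[OF assms(1) this, of y] assms(4) show ?thesis
    by (simp add: cross2_def)
qed

lemma generic_points_cross2:
  assumes "algebraically_independent (coords p q) (coord_index V L)"
    and "{u, v, w} \<subseteq> V" "u \<noteq> v" "u \<noteq> w" "v \<noteq> w"
  shows "cross2 (p u - p v) (p u - p w) \<noteq> 0"
proof -
  \<comment> \<open>Test point: \<open>u\<close> at the origin, \<open>v\<close> and
    \<open>w\<close> at the two unit vectors.\<close>
  let ?y = "\<lambda>z. of_bool (z = Inl (v, 1) \<or> z = Inl (w, 2)) :: real"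
  have "cross2 (\<chi> i. coords p q (Inl (u, i)) - coords p q (Inl (v, i)))
      (\<chi> i. coords p q (Inl (u, i)) - coords p q (Inl (w, i))) \<noteq> 0"
    using assms(2-) by (intro generic_cross2_nonzero[OF assms(1), where y = ?y
      and f = "\<lambda>x i. x (Inl (u, i)) - x (Inl (v, i))"
      and g = "\<lambda>x i. x (Inl (u, i)) - x (Inl (w, i))"])
      (auto intro!: polyfun_diff polyfun.var)
  moreover have "(\<chi> i. coords p q (Inl (a, i)) - coords p q (Inl (b, i))) = p a - p b" for a b
    by (simp add: vec_eq_iff)
  ultimately show ?thesis by simp
qed

lemma generic_loop_edge_cross2:
  assumes "algebraically_independent (coords p q) (coord_index V L)"
    and "{u, v} \<subseteq> V" "l \<in> L" "u \<noteq> v"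
  shows "cross2 (q l) (p u - p v) \<noteq> 0"
proof -
  \<comment> \<open>Test point: \<open>u\<close> and the direction of \<open>l\<close> are the two
    unit vectors, \<open>v\<close> is the origin.\<close>
  let ?y = "\<lambda>z. of_bool (z = Inl (u, 1) \<or> z = Inr (l, 2)) :: real"
  have "cross2 (\<chi> i. coords p q (Inr (l, i)))
      (\<chi> i. coords p q (Inl (u, i)) - coords p q (Inl (v, i))) \<noteq> 0"
    using assms(2-) by (intro generic_cross2_nonzero[OF assms(1), where y = ?y
      and f = "\<lambda>x i. x (Inr (l, i))"
      and g = "\<lambda>x i. x (Inl (u, i)) - x (Inl (v, i))"])
      (auto intro!: polyfun_diff polyfun.var)
  moreover have "(\<chi> i. coords p q (Inl (u, i)) - coords p q (Inl (v, i))) = p u - p v"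
    "(\<chi> i. coords p q (Inr (l, i))) = q l"
    by (simp_all add: vec_eq_iff)
  ultimately show ?thesis by simp
qed

lemma generic_loops_cross2:
  assumes "algebraically_independent (coords p q) (coord_index V L)"
    and "{l, l'} \<subseteq> L" "l \<noteq> l'"
  shows "cross2 (q l) (q l') \<noteq> 0"
proof -
  \<comment> \<open>Test point: the two directions are the unit vectors.\<close>
  let ?y = "\<lambda>z. of_bool (z = Inr (l, 1) \<or> z = Inr (l', 2)) :: real"
  have "cross2 (\<chi> i. coords p q (Inr (l, i))) (\<chi> i. coords p q (Inr (l', i))) \<noteq> 0"
    using assms(2-) by (intro generic_cross2_nonzero[OF assms(1), where y = ?y
      and f = "\<lambda>x i. x (Inr (l, i))"
      and g = "\<lambda>x i. x (Inr (l', i))"])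
      (auto intro!: polyfun_diff polyfun.var)
  moreover have "(\<chi> i. coords p q (Inr (l, i))) = q l" for l
    by (simp add: vec_eq_iff)
  ultimately show ?thesis by simp
qed

lemma generic_points_distinct:
  assumes "algebraically_independent (coords p q) (coord_index V L)"
    and "{u, v} \<subseteq> V" "u \<noteq> v"
  shows "p u \<noteq> p v"
proof -
  have "(\<lambda>x. x (Inl (u, 1)) - x (Inl (v, 1))) \<in> polyfun (coord_index V L)"
    using assms(2) by (intro polyfun_diff polyfun.var) auto
  from polyfun_nonzero_transfer[OF assms(1) this, of "\<lambda>z. of_bool (z = Inl (u, 1))"] assms(3)
  show ?thesis by auto
qed

lemma generic_loop_nonzero:
  assumes "algebraically_independent (coords p q) (coord_index V L)" "l \<in> L"
  shows "q l \<noteq> 0"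
proof -
  have "(\<lambda>x. x (Inr (l, 1))) \<in> polyfun (coord_index V L)"
    using assms(2) by (intro polyfun.var) auto
  from polyfun_nonzero_transfer[OF assms(1) this, of "\<lambda>z. 1"]
  show ?thesis by auto
qed

section \<open>Sparse sets\<close>

definition vset :: "('e \<Rightarrow> 'v set) \<Rightarrow> 'e set \<Rightarrow> 'v set" where
  "vset En A = (\<Union>e\<in>A. En e)"

text \<open>Nonempty, because the bound with \<open>3\<close> subtracted fails for the empty
  set.\<close>

definition all_edges :: "('e \<Rightarrow> 'v set) \<Rightarrow> 'e set \<Rightarrow> bool" where
  "all_edges En A \<longleftrightarrow> A \<noteq> {} \<and> (\<forall>e\<in>A. card (En e) = 2)"

text \<open>The \<open>3\<close> is added on the left because subtraction of natural numbers
  truncates. The bound for edge sets also excludes parallel edges.\<close>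

definition count_sparse :: "('e \<Rightarrow> 'v set) \<Rightarrow> 'e set \<Rightarrow> bool" where
  "count_sparse En I \<longleftrightarrow> finite I \<and> (\<forall>e\<in>I. card (En e) \<in> {1, 2}) \<and>
     (\<forall>A\<subseteq>I. card A \<le> 2 * card (vset En A) \<and>
       (all_edges En A \<longrightarrow> card A + 3 \<le> 2 * card (vset En A)))"

definition full_tight :: "('e \<Rightarrow> 'v set) \<Rightarrow> 'e set \<Rightarrow> bool" where
  "full_tight En A \<longleftrightarrow> card A = 2 * card (vset En A)"

definition edge_tight :: "('e \<Rightarrow> 'v set) \<Rightarrow> 'e set \<Rightarrow> bool" where
  "edge_tight En A \<longleftrightarrow> all_edges En A \<and> card A + 3 = 2 * card (vset En A)"

lemma vset_Un [simp]: "vset En (A \<union> B) = vset En A \<union> vset En B"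
  and vset_insert [simp]: "vset En (insert e A) = En e \<union> vset En A"
  and vset_empty [simp]: "vset En {} = {}"
  by (auto simp: vset_def)

lemma vset_mono: "A \<subseteq> B \<Longrightarrow> vset En A \<subseteq> vset En B"
  by (auto simp: vset_def)

lemma vset_Int_subset: "vset En (A \<inter> B) \<subseteq> vset En A \<inter> vset En B"
  by (auto simp: vset_def)

lemma vset_cong: "(\<And>e. e \<in> A \<Longrightarrow> En e = En' e) \<Longrightarrow> vset En A = vset En' A"
  by (simp add: vset_def)

lemma all_edges_cong: "(\<And>e. e \<in> A \<Longrightarrow> En e = En' e) \<Longrightarrow> all_edges En A \<longleftrightarrow> all_edges En' A"
  by (simp add: all_edges_def)

lemma all_edges_Un: "all_edges En A \<Longrightarrow> all_edges En B \<Longrightarrow> all_edges En (A \<union> B)"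
  by (auto simp: all_edges_def)

lemma all_edges_subset: "all_edges En A \<Longrightarrow> B \<subseteq> A \<Longrightarrow> B \<noteq> {} \<Longrightarrow> all_edges En B"
  by (auto simp: all_edges_def)

lemma sparse_cong:
  assumes "\<And>e. e \<in> I \<Longrightarrow> En e = En' e"
  shows "count_sparse En I \<longleftrightarrow> count_sparse En' I"
proof -
  have "vset En A = vset En' A \<and> (all_edges En A \<longleftrightarrow> all_edges En' A)" if "A \<subseteq> I" for A
    using that assms by (metis (no_types, lifting) vset_cong all_edges_cong subsetD)
  then show ?thesis
    using assms by (simp add: count_sparse_def)
qed

lemma sparse_subset: "count_sparse En I \<Longrightarrow> J \<subseteq> I \<Longrightarrow> count_sparse En J"
  by (auto simp: count_sparse_def intro: finite_subset)

lemma sparse_finite: "count_sparse En I \<Longrightarrow> finite I"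
  and sparse_card_ends: "count_sparse En I \<Longrightarrow> e \<in> I \<Longrightarrow> card (En e) \<in> {1, 2}"
  and sparse_card_le: "count_sparse En I \<Longrightarrow> A \<subseteq> I \<Longrightarrow> card A \<le> 2 * card (vset En A)"
  and sparse_edges_card_le:
    "count_sparse En I \<Longrightarrow> A \<subseteq> I \<Longrightarrow> all_edges En A \<Longrightarrow> card A + 3 \<le> 2 * card (vset En A)"
  by (simp_all add: count_sparse_def)

lemma full_tight_empty [simp]: "full_tight En {}"
  by (simp add: full_tight_def)

lemma full_tight_cong: "(\<And>e. e \<in> A \<Longrightarrow> En e = En' e) \<Longrightarrow> full_tight En A \<longleftrightarrow> full_tight En' A"
  using vset_cong[of A En En'] by (simp add: full_tight_def)

lemma edge_tight_cong: "(\<And>e. e \<in> A \<Longrightarrow> En e = En' e) \<Longrightarrow> edge_tight En A \<longleftrightarrow> edge_tight En' A"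
  using vset_cong[of A En En'] all_edges_cong[of A En En'] by (simp add: edge_tight_def)

text \<open>Adding \<open>e\<close> raises a count by one, and the bound by at least two if an end
  of \<open>e\<close> is new; so only a tight set that spans all ends of \<open>e\<close> can
  obstruct.\<close>

lemma sparse_insert:
  fixes En :: "'e \<Rightarrow> 'v::finite set"
  assumes I: "count_sparse En I" and e: "card (En e) \<in> {1, 2}"
    and full: "\<And>A. A \<subseteq> I \<Longrightarrow> full_tight En A \<Longrightarrow> \<not> En e \<subseteq> vset En A"
    and edge: "\<And>A. A \<subseteq> I \<Longrightarrow> edge_tight En A \<Longrightarrow> card (En e) = 2 \<Longrightarrow> \<not> En e \<subseteq> vset En A"
  shows "count_sparse En (insert e I)"
proof -
  have "card B \<le> 2 * card (vset En B) \<and>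
      (all_edges En B \<longrightarrow> card B + 3 \<le> 2 * card (vset En B))" if B: "B \<subseteq> insert e I" for B
  proof (cases "e \<in> B \<and> e \<notin> I")
    case False
    then have "B \<subseteq> I" using B by blast
    then show ?thesis
      using I sparse_card_le sparse_edges_card_le by blast
  next
    case True
    define A where "A = B - {e}"
    have A: "A \<subseteq> I" "B = insert e A" "e \<notin> A"
      using True B by (auto simp: A_def)
    have "finite A"
      using A(1) I by (meson sparse_finite finite_subset)
    then have card: "card B = card A + 1"
      using A by simp
    have le: "card (vset En A) \<le> card (vset En B)"
      and less: "\<not> En e \<subseteq> vset En A \<Longrightarrow> card (vset En A) < card (vset En B)"
      using A(2) by (auto intro!: card_mono psubset_card_mono)
    have "card B \<le> 2 * card (vset En B)"
      using sparse_card_le[OF I A(1)] full[OF A(1)] less le card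
      by (cases "full_tight En A") (auto simp: full_tight_def)
    moreover have "card B + 3 \<le> 2 * card (vset En B)" if edges: "all_edges En B"
    \<comment> \<open>The empty \<open>A\<close> is separate because it is not
      \<open>all_edges\<close>; the edge \<open>e\<close> alone meets its bound with equality,
      \<open>1 + 3 = 4\<close>.\<close>
    proof (cases "A = {}")
      case True
      then show ?thesis
        using A(2) edges by (simp add: all_edges_def)
    next
      case False
      then have A_edges: "all_edges En A"
        using all_edges_subset[OF edges] A(2) by blast
      moreover have "card (En e) = 2"
        using edges A(2) by (simp add: all_edges_def)
      ultimately show ?thesis
        using sparse_edges_card_le[OF I A(1)] edge[OF A(1)] less le card
        by (cases "edge_tight En A") (auto simp: edge_tight_def)
    qed
    ultimately show ?thesis by blast
  qed
  then show ?thesis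
    using I e by (simp add: count_sparse_def)
qed

section \<open>Unions of tight sets\<close>

lemma card_Un_Int_vset:
  fixes En :: "'e \<Rightarrow> 'v::finite set"
  shows "card (vset En A) + card (vset En B) = card (vset En (A \<union> B)) + card (vset En A \<inter> vset En B)"
  using card_Un_Int[of "vset En A" "vset En B"] by simp

lemma card_vset_Int_le:
  fixes En :: "'e \<Rightarrow> 'v::finite set"
  shows "card (vset En (A \<inter> B)) \<le> card (vset En A \<inter> vset En B)"
  by (intro card_mono vset_Int_subset) simp

text \<open>Submodularity: cardinalities add up exactly over union and intersection while vertex
  numbers can only drop, so tightness of both sets leaves no slack in the union.\<close>

lemma full_tight_Un:
  fixes En :: "'e \<Rightarrow> 'v::finite set"
  assumes I: "count_sparse En I" and A: "A \<subseteq> I" "full_tight En A" and B: "B \<subseteq> I" "full_tight En B"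
  shows "full_tight En (A \<union> B)"
proof -
  have "card A + card B = card (A \<union> B) + card (A \<inter> B)"
    using A(1) B(1) sparse_finite[OF I] by (meson card_Un_Int finite_subset)
  moreover have "card (A \<union> B) \<le> 2 * card (vset En (A \<union> B))"
    "card (A \<inter> B) \<le> 2 * card (vset En (A \<inter> B))"
    using A(1) B(1) by (intro sparse_card_le[OF I]; blast)+
  ultimately show ?thesis
    using A(2) B(2) card_Un_Int_vset[of En A B] card_vset_Int_le[of En A B]
    unfolding full_tight_def by linarith
qed

text \<open>The deficit \<open>3\<close> of \<open>B\<close> is passed on to the intersection, which
  leaves the union without any.\<close>

lemma full_tight_Un_edge_tight:
  fixes En :: "'e \<Rightarrow> 'v::finite set"
  assumes I: "count_sparse En I" and A: "A \<subseteq> I" "full_tight En A" and B: "B \<subseteq> I" "edge_tight En B"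
    and meet: "card (vset En A \<inter> vset En B) \<ge> 2"
  shows "full_tight En (A \<union> B)"
proof -
  have card: "card A + card B = card (A \<union> B) + card (A \<inter> B)"
    using A(1) B(1) sparse_finite[OF I] by (meson card_Un_Int finite_subset)
  have Un: "card (A \<union> B) \<le> 2 * card (vset En (A \<union> B))"
    using A(1) B(1) by (intro sparse_card_le[OF I] Un_least)
  \<comment> \<open>A nonempty intersection consists of edges and has deficit \<open>3\<close>; an
    empty one satisfies the inequality because two common vertices give \<open>4\<close>.\<close>
  have "card (A \<inter> B) + 3 \<le> 2 * card (vset En A \<inter> vset En B)"
  proof (cases "A \<inter> B = {}")
    case False
    then have "card (A \<inter> B) + 3 \<le> 2 * card (vset En (A \<inter> B))"
      using A(1) B all_edges_subset[of En B "A \<inter> B"]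
      by (intro sparse_edges_card_le[OF I]) (auto simp: edge_tight_def)
    then show ?thesis
      using card_vset_Int_le[of En A B] by linarith
  qed (use meet in simp)
  then show ?thesis
    using card Un A(2) B(2) card_Un_Int_vset[of En A B]
    unfolding full_tight_def edge_tight_def by linarith
qed

text \<open>One of the two deficits \<open>3\<close> goes to the intersection, the other stays with
  the union.\<close>

lemma edge_tight_Un:
  fixes En :: "'e \<Rightarrow> 'v::finite set"
  assumes I: "count_sparse En I" and A: "A \<subseteq> I" "edge_tight En A" and B: "B \<subseteq> I" "edge_tight En B"
    and meet: "card (vset En A \<inter> vset En B) \<ge> 2"
  shows "edge_tight En (A \<union> B)"
proof -
  have card: "card A + card B = card (A \<union> B) + card (A \<inter> B)"
    using A(1) B(1) sparse_finite[OF I] by (meson card_Un_Int finite_subset)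
  have edges: "all_edges En (A \<union> B)"
    using A(2) B(2) by (simp add: edge_tight_def all_edges_Un)
  then have Un: "card (A \<union> B) + 3 \<le> 2 * card (vset En (A \<union> B))"
    using A(1) B(1) by (intro sparse_edges_card_le[OF I] Un_least)
  have "card (A \<inter> B) + 3 \<le> 2 * card (vset En A \<inter> vset En B)"
  proof (cases "A \<inter> B = {}")
    case False
    then have "card (A \<inter> B) + 3 \<le> 2 * card (vset En (A \<inter> B))"
      using A(1) B all_edges_subset[of En B "A \<inter> B"]
      by (intro sparse_edges_card_le[OF I]) (auto simp: edge_tight_def)
    then show ?thesis
      using card_vset_Int_le[of En A B] by linarith
  qed (use meet in simp)
  then show ?thesis
    using card edges Un A(2) B(2) card_Un_Int_vset[of En A B]
    unfolding edge_tight_def by linarith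
qed

text \<open>A common element would put both its ends into both vertex sets.\<close>

lemma Int_empty_of_card_vset_Int_le_1:
  fixes En :: "'e \<Rightarrow> 'v::finite set"
  assumes "card (vset En A \<inter> vset En B) \<le> 1" "\<And>e. e \<in> B \<Longrightarrow> card (En e) = 2"
  shows "A \<inter> B = {}"
proof (rule ccontr)
  assume "A \<inter> B \<noteq> {}"
  then obtain e where e: "e \<in> A" "e \<in> B" by blast
  then have "En e \<subseteq> vset En A \<inter> vset En B"
    by (auto simp: vset_def)
  then have "card (En e) \<le> card (vset En A \<inter> vset En B)"
    by (intro card_mono) simp_all
  with assms e show False by fastforce
qed

lemma singleton_of_card_le_1: "finite S \<Longrightarrow> card S \<le> 1 \<Longrightarrow> a \<in> S \<Longrightarrow> S = {a}"
  using card_le_Suc0_iff_eq[of S] by auto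

text \<open>If two of the sets share a second vertex, already their union is tight; otherwise they meet
  only in the corners of a triangle and their cardinalities add up.\<close>

lemma tight_triangle:
  fixes En :: "'e \<Rightarrow> 'v::finite set"
  assumes I: "count_sparse En I" and sub: "A \<subseteq> I" "B \<subseteq> I" "C \<subseteq> I"
    and A: "full_tight En A \<or> edge_tight En A" and B: "edge_tight En B" and C: "edge_tight En C"
    and distinct: "u \<noteq> w" "u \<noteq> x" "w \<noteq> x"
    and vA: "u \<in> vset En A" "w \<in> vset En A" and vB: "u \<in> vset En B" "x \<in> vset En B"
    and vC: "w \<in> vset En C" "x \<in> vset En C"
  shows "\<exists>D\<subseteq>I. (full_tight En D \<or> edge_tight En D) \<and> {u, w, x} \<subseteq> vset En D"
proof -
  consider "card (vset En A \<inter> vset En B) \<ge> 2" | "card (vset En A \<inter> vset En C) \<ge> 2"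
    | "card (vset En B \<inter> vset En C) \<ge> 2"
    | "card (vset En A \<inter> vset En B) \<le> 1" "card (vset En A \<inter> vset En C) \<le> 1"
      "card (vset En B \<inter> vset En C) \<le> 1"
    by linarith
  then show ?thesis
  proof cases
    case 1
    then have "full_tight En (A \<union> B) \<or> edge_tight En (A \<union> B)"
      using full_tight_Un_edge_tight[OF I sub(1) _ sub(2) B] edge_tight_Un[OF I sub(1) _ sub(2) B] A
      by blast
    then show ?thesis
      using sub vA vB by (intro exI[of _ "A \<union> B"]) auto
  next
    case 2
    then have "full_tight En (A \<union> C) \<or> edge_tight En (A \<union> C)"
      using full_tight_Un_edge_tight[OF I sub(1) _ sub(3) C] edge_tight_Un[OF I sub(1) _ sub(3) C] A
      by blast
    then show ?thesis
      using sub vA vC by (intro exI[of _ "A \<union> C"]) auto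
  next
    case 3
    then have "edge_tight En (B \<union> C)"
      using edge_tight_Un[OF I sub(2) B sub(3) C] by blast
    then show ?thesis
      using sub vB vC by (intro exI[of _ "B \<union> C"]) auto
  next
    case 4
    have fin: "finite A" "finite B" "finite C"
      using sub sparse_finite[OF I] by (auto intro: finite_subset)
    have "card (En e) = 2" if "e \<in> B \<union> C" for e
      using that B C by (auto simp: edge_tight_def all_edges_def)
    then have "A \<inter> B = {}" "A \<inter> C = {}" "B \<inter> C = {}"
      using 4 by (auto intro!: Int_empty_of_card_vset_Int_le_1)
    then have card: "card (A \<union> B \<union> C) = card A + card B + card C"
      using fin card_Un_disjoint[of A B] card_Un_disjoint[of "A \<union> B" C] by (simp add: Int_Un_distrib2)
    have "vset En A \<inter> vset En B = {u}"
      using 4(1) vA vB by (intro singleton_of_card_le_1) auto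
    moreover have "vset En A \<inter> vset En C = {w}"
      using 4(2) vA vC by (intro singleton_of_card_le_1) auto
    moreover have "vset En B \<inter> vset En C = {x}"
      using 4(3) vB vC by (intro singleton_of_card_le_1) auto
    ultimately have "(vset En A \<union> vset En B) \<inter> vset En C = {w, x}"
      "vset En A \<inter> vset En B = {u}"
      by auto
    then have "card (vset En A) + card (vset En B) + card (vset En C)
        = card (vset En (A \<union> B \<union> C)) + 3"
      using card_Un_Int_vset[of En A B] card_Un_Int_vset[of En "A \<union> B" C] distinct by simp
    moreover have "all_edges En (A \<union> B \<union> C)" if "edge_tight En A"
      using that B C by (simp add: edge_tight_def all_edges_Un)
    \<comment> \<open>The three corners are counted twice and contribute \<open>6\<close>, which
      cancels the deficits \<open>3\<close> of \<open>B\<close> and \<open>C\<close>; the union is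
      tight in the same sense as \<open>A\<close>.\<close>
    ultimately have "full_tight En (A \<union> B \<union> C) \<or> edge_tight En (A \<union> B \<union> C)"
      using card A B C unfolding full_tight_def edge_tight_def by linarith
    then show ?thesis
      using sub vA vB by (intro exI[of _ "A \<union> B \<union> C"]) auto
  qed
qed

text \<open>Double counting of incidences: minimum degree 4 would need at least
  \<open>4 * card (vset En I)\<close> of them, which the count bounds rule out.\<close>

lemma exists_vertex_of_degree_le_3:
  fixes En :: "'e \<Rightarrow> 'v::finite set"
  assumes I: "count_sparse En I" and "I \<noteq> {}"
  shows "\<exists>v\<in>vset En I. card {e\<in>I. v \<in> En e} \<le> 3"
proof (rule ccontr)
  assume "\<not> ?thesis"
  then have deg: "4 \<le> card {e\<in>I. v \<in> En e}" if "v \<in> vset En I" for v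
    using that by force
  note fin = sparse_finite[OF I]
  have "4 * card (vset En I) \<le> (\<Sum>v\<in>vset En I. card {e\<in>I. v \<in> En e})"
    using sum_bounded_below[of "vset En I" 4 "\<lambda>v. card {e\<in>I. v \<in> En e}"] deg by simp
  also have "\<dots> = (\<Sum>e\<in>I. card {v\<in>vset En I. v \<in> En e})"
    using fin by (intro sum_multicount_gen[symmetric]) auto
  also have "\<dots> = (\<Sum>e\<in>I. card (En e))"
    by (intro sum.cong refl arg_cong[where f = card]) (auto simp: vset_def)
  finally have le: "4 * card (vset En I) \<le> (\<Sum>e\<in>I. card (En e))" .
  have ends: "card (En e) \<in> {1, 2}" if "e \<in> I" for e
    using sparse_card_ends[OF I that] .
  show False
  proof (cases "\<forall>e\<in>I. card (En e) = 2")
    case True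
    then have "card I + 3 \<le> 2 * card (vset En I)"
      using assms by (intro sparse_edges_card_le[OF I]) (auto simp: all_edges_def)
    with le True show False by simp
  next
    \<comment> \<open>A loop has only one end, so the sum is strictly below
      \<open>2 * card I\<close>.\<close>
    case False
    then have "(\<Sum>e\<in>I. card (En e)) < (\<Sum>e\<in>I. 2)"
      using ends fin by (intro sum_strict_mono_ex1) force+
    then show False
      using le sparse_card_le[OF I order_refl] by simp
  qed
qed

text \<open>Two full tight sets have a full tight union that already covers the three vertices.
  Otherwise at least two sets are edge tight, and \<open>tight_triangle\<close> applies with the
  third one in the role of \<open>A\<close>.\<close>

lemma three_tight_sets:
  fixes En :: "'e \<Rightarrow> 'v::finite set"
  assumes I: "count_sparse En I" and sub: "A \<subseteq> I" "B \<subseteq> I" "C \<subseteq> I"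
    and A: "full_tight En A \<or> edge_tight En A" and B: "full_tight En B \<or> edge_tight En B"
    and C: "full_tight En C \<or> edge_tight En C"
    and distinct: "u \<noteq> w" "u \<noteq> x" "w \<noteq> x"
    and v: "{u, w} \<subseteq> vset En A" "{u, x} \<subseteq> vset En B" "{w, x} \<subseteq> vset En C"
  shows "\<exists>D\<subseteq>I. (full_tight En D \<or> edge_tight En D) \<and> {u, w, x} \<subseteq> vset En D"
proof -
  consider "full_tight En A" "full_tight En B" | "full_tight En A" "full_tight En C"
    | "full_tight En B" "full_tight En C" | "edge_tight En B" "edge_tight En C"
    | "edge_tight En A" "edge_tight En C" | "edge_tight En A" "edge_tight En B"
    using A B C by blast
  then show ?thesis
  proof cases
    case 1
    then have "full_tight En (A \<union> B)"
      using full_tight_Un[OF I] sub by blast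
    then show ?thesis
      using sub v by (intro exI[of _ "A \<union> B"]) auto
  next
    case 2
    then have "full_tight En (A \<union> C)"
      using full_tight_Un[OF I] sub by blast
    then show ?thesis
      using sub v by (intro exI[of _ "A \<union> C"]) auto
  next
    case 3
    then have "full_tight En (B \<union> C)"
      using full_tight_Un[OF I] sub by blast
    then show ?thesis
      using sub v by (intro exI[of _ "B \<union> C"]) auto
  next
    case 4
    show ?thesis
      using tight_triangle[OF I sub A 4 distinct] v by auto
  next
    case 5
    show ?thesis
      using tight_triangle[OF I sub(2,1,3) B 5, of u x w] distinct v by auto
  next
    case 6
    show ?thesis
      using tight_triangle[OF I sub(3,1,2) C 6, of w x u] distinct v by auto
  qed
qed

section \<open>Henneberg extensions\<close>

text \<open>Only the rows in \<open>S\<close> reach the columns of \<open>v\<close>, so the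
  coefficients of a relation vanish first on \<open>S\<close> and then on the rest.\<close>

lemma indep_family_0_extension:
  fixes r :: "'e \<Rightarrow> real^'n^'m"
  assumes "finite I" "S \<subseteq> I" "\<And>e. e \<in> I - S \<Longrightarrow> r e $ v = 0"
    and J: "indep_family r (I - S)"
    and S: "\<And>c. (\<Sum>e\<in>S. c e *\<^sub>R r e $ v) = 0 \<Longrightarrow> \<forall>e\<in>S. c e = 0"
  shows "indep_family r I"
  unfolding indep_family_def
proof (intro allI impI)
  fix c assume "(\<Sum>e\<in>I. c e *\<^sub>R r e) = 0"
  then have eq: "(\<Sum>e\<in>I - S. c e *\<^sub>R r e) + (\<Sum>e\<in>S. c e *\<^sub>R r e) = 0"
    using assms(1,2) by (simp add: sum.subset_diff)
  have "(\<Sum>e\<in>I - S. c e *\<^sub>R r e) $ v = 0"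
    using assms(3) by simp
  then have "(\<Sum>e\<in>S. c e *\<^sub>R r e $ v) = 0"
    using arg_cong[OF eq, of "\<lambda>x. x $ v"] by simp
  then have "\<forall>e\<in>S. c e = 0"
    by (rule S)
  moreover from this have "\<forall>e\<in>I - S. c e = 0"
    using eq J unfolding indep_family_def by simp
  ultimately show "\<forall>e\<in>I. c e = 0" by blast
qed

text \<open>The part of a relation on \<open>S\<close> vanishes in the columns of \<open>v\<close>;
  by the last assumption it is a multiple of the replacement row \<open>s a\<close>, so the relation
  becomes one of the smaller family.\<close>

lemma indep_family_1_extension:
  fixes r s :: "'e \<Rightarrow> real^'n^'m"
  assumes "finite I" "S \<subseteq> I" "a \<in> S" "\<And>e. e \<in> I - S \<Longrightarrow> r e = s e"
    and zero: "\<And>e. e \<in> I - S \<Longrightarrow> s e $ v = 0"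
    and J: "indep_family s (insert a (I - S))"
    and S: "\<And>c. (\<Sum>e\<in>S. c e *\<^sub>R r e $ v) = 0 \<Longrightarrow>
      \<exists>k. (\<Sum>e\<in>S. c e *\<^sub>R r e) = k *\<^sub>R s a \<and> (k = 0 \<longrightarrow> (\<forall>e\<in>S. c e = 0))"
  shows "indep_family r I"
  unfolding indep_family_def
proof (intro allI impI)
  fix c assume "(\<Sum>e\<in>I. c e *\<^sub>R r e) = 0"
  then have "(\<Sum>e\<in>I - S. c e *\<^sub>R r e) + (\<Sum>e\<in>S. c e *\<^sub>R r e) = 0"
    using assms(1,2) by (simp add: sum.subset_diff)
  then have eq: "(\<Sum>e\<in>I - S. c e *\<^sub>R s e) + (\<Sum>e\<in>S. c e *\<^sub>R r e) = 0"
    using assms(4) by simp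
  have "(\<Sum>e\<in>I - S. c e *\<^sub>R s e) $ v = 0"
    using zero by simp
  then have "(\<Sum>e\<in>S. c e *\<^sub>R r e $ v) = 0"
    using arg_cong[OF eq, of "\<lambda>x. x $ v"] by simp
  from S[OF this] obtain k where k: "(\<Sum>e\<in>S. c e *\<^sub>R r e) = k *\<^sub>R s a"
    "k = 0 \<longrightarrow> (\<forall>e\<in>S. c e = 0)"
    by blast
  \<comment> \<open>\<open>a\<close> lies outside \<open>I - S\<close>, so its coefficient is free
    to record the multiple.\<close>
  let ?c = "c(a := k)"
  have "(\<Sum>e\<in>I - S. ?c e *\<^sub>R s e) = (\<Sum>e\<in>I - S. c e *\<^sub>R s e)"
    using assms(3) by (intro sum.cong) auto
  then have "(\<Sum>e\<in>insert a (I - S). ?c e *\<^sub>R s e) = 0"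
    using assms(1,3) eq k(1) by (simp add: add.commute)
  then have "\<forall>e\<in>insert a (I - S). ?c e = 0"
    using J unfolding indep_family_def by blast
  then have "k = 0" "\<forall>e\<in>I - S. c e = 0"
    using assms(3) by (auto split: if_splits)
  with k(2) show "\<forall>e\<in>I. c e = 0" by blast
qed

lemma cross2_commute: "cross2 a b = - cross2 b a"
  by (simp add: cross2_def)

lemma incident_cases:
  assumes "card (En e) \<in> {1, 2}" "v \<in> En e"
  obtains (loop) "En e = {v}" | (edge) u where "En e = {v, u}" "u \<noteq> v"
proof -
  from assms(1) consider "card (En e) = 1" | "card (En e) = 2" by auto
  then show thesis
  proof cases
    case 1
    then obtain x where "En e = {x}" by (rule card_1_singletonE)
    with assms(2) loop show thesis by simp
  next
    case 2
    then obtain x y where "En e = {x, y}" "x \<noteq> y" by (auto simp: card_2_iff)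
    with assms(2) edge[of x] edge[of y] show thesis by (auto simp: insert_commute)
  qed
qed

text \<open>Parallel edges would be two elements on two vertices, one more than allowed.\<close>

lemma sparse_edges_distinct_ends:
  assumes I: "count_sparse En I"
    and "e \<in> I" "f \<in> I" "e \<noteq> f" "En e = {v, u}" "u \<noteq> v" "En f = {v, w}" "w \<noteq> v"
  shows "u \<noteq> w"
proof
  assume "u = w"
  then have "card {e, f} + 3 \<le> 2 * card (vset En {e, f})"
    using assms by (intro sparse_edges_card_le[OF I]) (auto simp: all_edges_def)
  then show False
    using assms \<open>u = w\<close> by simp
qed

text \<open>Each pairing of loops and edges has its generic determinant; for two edges, sparsity
  provides the distinct neighbours.\<close>

lemma incident_rows_cross2_nonzero:
  fixes En :: "'e \<Rightarrow> 'v::finite set"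
  assumes I: "count_sparse En I" and ef: "e \<in> I" "f \<in> I" "e \<noteq> f" "v \<in> En e" "v \<in> En f"
    and generic: "algebraically_independent (coords p q) (coord_index UNIV I)"
  shows "cross2 (lc_row En p q e $ v) (lc_row En p q f $ v) \<noteq> 0"
proof -
  have ends: "card (En e) \<in> {1, 2}" "card (En f) \<in> {1, 2}"
    using sparse_card_ends[OF I] ef by blast+
  show ?thesis
    using ends(1) ef(4)
  proof (cases rule: incident_cases)
    case loop
    show ?thesis
      using ends(2) ef(5)
    proof (cases rule: incident_cases)
      case loop': loop
      show ?thesis
        using generic_loops_cross2[OF generic, of e f] ef loop loop' by (simp add: lc_row_loop)
    next
      case (edge u)
      show ?thesis
        using generic_loop_edge_cross2[OF generic, of v u e] ef loop edge
        by (simp add: lc_row_loop lc_row_edge)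
    qed
  next
    case (edge u)
    show ?thesis
      using ends(2) ef(5)
    proof (cases rule: incident_cases)
      case loop
      show ?thesis
        using generic_loop_edge_cross2[OF generic, of v u f] ef loop edge
        by (subst cross2_commute) (simp add: lc_row_loop lc_row_edge)
    next
      case edge': (edge w)
      have "u \<noteq> w"
        using sparse_edges_distinct_ends[OF I ef(1-3) edge edge'] .
      then show ?thesis
        using generic_points_cross2[OF generic, of v u w] edge edge' by (simp add: lc_row_edge)
    qed
  qed
qed

lemma incident_row_nonzero:
  fixes En :: "'e \<Rightarrow> 'v::finite set"
  assumes "e \<in> I" "card (En e) \<in> {1, 2}" "v \<in> En e"
    and generic: "algebraically_independent (coords p q) (coord_index UNIV I)"
  shows "lc_row En p q e $ v \<noteq> 0"
  using assms(2,3)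
proof (cases rule: incident_cases)
  case loop
  then show ?thesis
    using generic_loop_nonzero[OF generic] assms(1) by (simp add: lc_row_loop)
next
  case (edge u)
  then show ?thesis
    using generic_points_distinct[OF generic, of v u] by (simp add: lc_row_edge)
qed

text \<open>The placement is generic for all of \<open>I\<close>, so that the deleted vertex and the
  deleted elements have generic data as well.\<close>

lemma generic_realization:
  fixes En :: "'e \<Rightarrow> 'v::finite set"
  assumes "count_sparse En J" "J \<subseteq> I" "finite I" "\<exists>p q. indep_family (lc_row En p q) J"
  shows "\<exists>p q. algebraically_independent (coords p q) (coord_index UNIV I) \<and>
    indep_family (lc_row En p q) J"
proof -
  obtain p q where pq: "algebraically_independent (coords p q) (coord_index (UNIV :: 'v set) I)"
    using generic_exists[OF finite_class.finite_UNIV assms(3)] by blast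
  obtain p' q' where "indep_family (lc_row En p' q') J"
    using assms(4) by blast
  then have "indep_family (lc_row En p q) J"
    using assms(2) sparse_finite[OF assms(1)] sparse_card_ends[OF assms(1)]
    by (intro indep_family_generic[OF _ _ _ pq]) auto
  with pq show ?thesis by blast
qed

text \<open>At most two rows are nonzero at \<open>v\<close>, and generically they are independent
  there.\<close>

lemma realization_degree_le_2:
  fixes En :: "'e \<Rightarrow> 'v::finite set"
  assumes I: "count_sparse En I" and S: "S = {e\<in>I. v \<in> En e}" "S \<noteq> {}" "card S \<le> 2"
    and J: "\<exists>p q. indep_family (lc_row En p q) (I - S)"
  shows "\<exists>p q. indep_family (lc_row En p q) I"
proof -
  have fin: "finite I" using I by (rule sparse_finite)
  obtain p q where generic: "algebraically_independent (coords p q) (coord_index UNIV I)"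
    and indep: "indep_family (lc_row En p q) (I - S)"
    using generic_realization[OF sparse_subset[OF I] _ fin J] by blast
  have "\<forall>e\<in>S. c e = 0" if c: "(\<Sum>e\<in>S. c e *\<^sub>R lc_row En p q e $ v) = 0" for c
  proof -
    have "finite S" using fin S(1) by simp
    then have "card S = 1 \<or> card S = 2"
      using S(2,3) by (cases "card S") auto
    then show ?thesis
    proof
      assume "card S = 1"
      then obtain e where e: "S = {e}" by (rule card_1_singletonE)
      then have "e \<in> I" "v \<in> En e" using S(1) by auto
      then have "lc_row En p q e $ v \<noteq> 0"
        using incident_row_nonzero[OF _ _ _ generic] sparse_card_ends[OF I] by blast
      with c e show ?thesis by simp
    next
      assume "card S = 2"
      then obtain e f where ef: "S = {e, f}" "e \<noteq> f" by (auto simp: card_2_iff)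
      then have "e \<in> I" "v \<in> En e" "f \<in> I" "v \<in> En f" using S(1) by auto
      then have "cross2 (lc_row En p q e $ v) (lc_row En p q f $ v) \<noteq> 0"
        using incident_rows_cross2_nonzero[OF I _ _ _ _ _ generic] ef by blast
      with c ef cross2_independent[of _ _ "c e" "c f"] show ?thesis by simp
    qed
  qed
  then have "indep_family (lc_row En p q) I"
    using fin S(1) indep
    by (intro indep_family_0_extension[of I S _ v]) (auto simp: lc_row_not_incident)
  then show ?thesis by blast
qed

text \<open>The obstructions of \<open>sparse_insert\<close> for a new element with ends
  \<open>N\<close>: an edge tight set obstructs an edge but not a loop.\<close>

definition blocked :: "('e \<Rightarrow> 'v set) \<Rightarrow> 'e set \<Rightarrow> 'v set \<Rightarrow> bool" where
  "blocked En J N \<longleftrightarrow>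
     (\<exists>A\<subseteq>J. (full_tight En A \<or> edge_tight En A \<and> card N = 2) \<and> N \<subseteq> vset En A)"

lemma blockedE:
  assumes "blocked En J N"
  obtains A where "A \<subseteq> J" "full_tight En A \<or> edge_tight En A" "N \<subseteq> vset En A"
  using assms by (auto simp: blocked_def)

text \<open>The inductive step in degree 3. The name \<open>e\<^sub>1\<close> is reused for the new
  element, hence \<open>smaller\<close> ranges over all incidence maps.\<close>

locale degree_3_vertex =
  fixes En :: "'e \<Rightarrow> 'v::finite set" and I :: "'e set" and v :: 'v and e\<^sub>1 e\<^sub>2 e\<^sub>3 :: 'e
  assumes sparse: "count_sparse En I"
    and star: "{e\<in>I. v \<in> En e} = {e\<^sub>1, e\<^sub>2, e\<^sub>3}"
    and distinct: "e\<^sub>1 \<noteq> e\<^sub>2" "e\<^sub>1 \<noteq> e\<^sub>3" "e\<^sub>2 \<noteq> e\<^sub>3"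
    and smaller: "\<And>(En' :: 'e \<Rightarrow> 'v set) (I' :: 'e set). count_sparse En' I' \<Longrightarrow> card I' < card I \<Longrightarrow>
      \<exists>p q. indep_family (lc_row En' p q) I'"
begin

abbreviation "J \<equiv> I - {e\<^sub>1, e\<^sub>2, e\<^sub>3}"

lemma finite_I: "finite I"
  using sparse by (rule sparse_finite)

lemma star_in_I: "e\<^sub>1 \<in> I" "e\<^sub>2 \<in> I" "e\<^sub>3 \<in> I"
  using star by blast+

lemma not_incident: "e \<in> J \<Longrightarrow> v \<notin> En e"
  using star by blast

text \<open>The star contributes three elements but at most the one vertex \<open>v\<close>; this is
  the overcount behind the next two lemmas.\<close>

lemma card_tight_Un_star:
  assumes "A \<subseteq> J" "En e\<^sub>1 \<union> En e\<^sub>2 \<union> En e\<^sub>3 \<subseteq> insert v (vset En A)"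
  shows "card (A \<union> {e\<^sub>1, e\<^sub>2, e\<^sub>3}) = card A + 3"
    and "card (vset En (A \<union> {e\<^sub>1, e\<^sub>2, e\<^sub>3})) \<le> card (vset En A) + 1"
proof -
  have "finite A" using assms(1) finite_I by (meson finite_Diff finite_subset)
  then show "card (A \<union> {e\<^sub>1, e\<^sub>2, e\<^sub>3}) = card A + 3"
    using assms(1) distinct by (subst card_Un_disjoint) auto
  have "card (vset En (A \<union> {e\<^sub>1, e\<^sub>2, e\<^sub>3})) \<le> card (insert v (vset En A))"
    using assms(2) by (intro card_mono) auto
  then show "card (vset En (A \<union> {e\<^sub>1, e\<^sub>2, e\<^sub>3})) \<le> card (vset En A) + 1"
    by (simp add: card_insert_if split: if_splits)
qed

lemma not_full_tight:
  assumes "A \<subseteq> J" "En e\<^sub>1 \<union> En e\<^sub>2 \<union> En e\<^sub>3 \<subseteq> insert v (vset En A)"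
  shows "\<not> full_tight En A"
proof -
  have "card (A \<union> {e\<^sub>1, e\<^sub>2, e\<^sub>3}) \<le> 2 * card (vset En (A \<union> {e\<^sub>1, e\<^sub>2, e\<^sub>3}))"
    using assms(1) star_in_I by (intro sparse_card_le[OF sparse]) blast
  with card_tight_Un_star[OF assms] show ?thesis
    unfolding full_tight_def by linarith
qed

lemma not_edge_tight:
  assumes "A \<subseteq> J" "En e\<^sub>1 \<union> En e\<^sub>2 \<union> En e\<^sub>3 \<subseteq> insert v (vset En A)"
    and "all_edges En {e\<^sub>1, e\<^sub>2, e\<^sub>3}"
  shows "\<not> edge_tight En A"
proof
  assume A: "edge_tight En A"
  have "card (A \<union> {e\<^sub>1, e\<^sub>2, e\<^sub>3}) + 3 \<le> 2 * card (vset En (A \<union> {e\<^sub>1, e\<^sub>2, e\<^sub>3}))"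
    using assms(1,3) A star_in_I
    by (intro sparse_edges_card_le[OF sparse] all_edges_Un) (auto simp: edge_tight_def)
  with card_tight_Un_star[OF assms(1,2)] A show False
    unfolding edge_tight_def by linarith
qed

text \<open>Giving \<open>e\<^sub>1\<close> the ends \<open>N\<close> and dropping
  \<open>e\<^sub>2\<close> and \<open>e\<^sub>3\<close> keeps the set sparse and lowers its size by
  two.\<close>

lemma reduction:
  assumes N: "card N \<in> {1, 2}" and unblocked: "\<not> blocked En J N"
  shows "\<exists>p q. algebraically_independent (coords p q) (coord_index UNIV I) \<and>
    indep_family (lc_row (En(e\<^sub>1 := N)) p q) (insert e\<^sub>1 J)"
proof -
  let ?En = "En(e\<^sub>1 := N)"
  have J: "count_sparse En J"
    using sparse by (rule sparse_subset) blast
  have cong: "vset ?En A = vset En A \<and> (full_tight ?En A \<longleftrightarrow> full_tight En A)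
      \<and> (edge_tight ?En A \<longleftrightarrow> edge_tight En A)" if "A \<subseteq> J" for A
    using that by (intro conjI vset_cong full_tight_cong edge_tight_cong) auto
  have "count_sparse ?En (insert e\<^sub>1 J)"
  proof (rule sparse_insert)
    show "count_sparse ?En J"
      using J by (subst sparse_cong[of _ _ En]) auto
  qed (use N unblocked cong in \<open>auto simp: blocked_def\<close>)
  moreover have "card (insert e\<^sub>1 J) < card I"
    using finite_I star_in_I distinct by (intro psubset_card_mono) auto
  ultimately show ?thesis
    using star_in_I smaller finite_I by (intro generic_realization) auto
qed

text \<open>The 1-extension with the star as \<open>S\<close>: \<open>p\<close> may be altered at
  \<open>v\<close> and \<open>q\<close> outside \<open>J\<close>, which is where the special
  position is chosen.\<close>

lemma extension:
  assumes N: "v \<notin> N"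
    and indep: "indep_family (lc_row (En(e\<^sub>1 := N)) p q) (insert e\<^sub>1 J)"
    and p': "\<And>w. w \<noteq> v \<Longrightarrow> p' w = p w" and q': "\<And>e. e \<in> J \<Longrightarrow> q' e = q e"
    and rel: "\<And>c\<^sub>1 c\<^sub>2 c\<^sub>3. c\<^sub>1 *\<^sub>R lc_row En p' q' e\<^sub>1 $ v + c\<^sub>2 *\<^sub>R lc_row En p' q' e\<^sub>2 $ v
        + c\<^sub>3 *\<^sub>R lc_row En p' q' e\<^sub>3 $ v = 0 \<Longrightarrow>
      \<exists>k. c\<^sub>1 *\<^sub>R lc_row En p' q' e\<^sub>1 + c\<^sub>2 *\<^sub>R lc_row En p' q' e\<^sub>2 + c\<^sub>3 *\<^sub>R lc_row En p' q' e\<^sub>3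
          = k *\<^sub>R lc_row (En(e\<^sub>1 := N)) p q e\<^sub>1 \<and>
        (k = 0 \<longrightarrow> c\<^sub>1 = 0 \<and> c\<^sub>2 = 0 \<and> c\<^sub>3 = 0)"
  shows "\<exists>p q. indep_family (lc_row En p q) I"
proof -
  have "indep_family (lc_row En p' q') I"
  proof (rule indep_family_1_extension[OF finite_I _ _ _ _ indep, where v = v])
    fix e assume e: "e \<in> J"
    then have "v \<notin> En e" by (rule not_incident)
    moreover have "card (En e) \<in> {1, 2}"
      using e sparse_card_ends[OF sparse] by blast
    moreover have "p' w = p w" if "w \<in> En e" for w
      using that \<open>v \<notin> En e\<close> by (intro p') blast
    ultimately show "lc_row En p' q' e = lc_row (En(e\<^sub>1 := N)) p q e"
      using e q' by (intro lc_row_cong) auto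
  next
    fix c assume "(\<Sum>e\<in>{e\<^sub>1, e\<^sub>2, e\<^sub>3}. c e *\<^sub>R lc_row En p' q' e $ v) = 0"
    then show "\<exists>k. (\<Sum>e\<in>{e\<^sub>1, e\<^sub>2, e\<^sub>3}. c e *\<^sub>R lc_row En p' q' e) = k *\<^sub>R lc_row (En(e\<^sub>1 := N)) p q e\<^sub>1 \<and>
        (k = 0 \<longrightarrow> (\<forall>e\<in>{e\<^sub>1, e\<^sub>2, e\<^sub>3}. c e = 0))"
      using rel[of "c e\<^sub>1" "c e\<^sub>2" "c e\<^sub>3"] distinct by (simp add: add.assoc)
  qed (use star_in_I not_incident in \<open>auto intro: lc_row_not_incident\<close>)
  then show ?thesis by blast
qed

lemma realization_edge_loop_loop:
  assumes ends: "En e\<^sub>1 = {v, u}" "u \<noteq> v" "En e\<^sub>2 = {v}" "En e\<^sub>3 = {v}"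
  shows "\<exists>p q. indep_family (lc_row En p q) I"
proof -
  \<comment> \<open>A single vertex can only be blocked by a full tight set, and adding the star to
    it would exceed the count.\<close>
  have "\<not> blocked En J {u}"
    using not_full_tight ends by (auto simp: blocked_def)
  then obtain p q where indep: "indep_family (lc_row (En(e\<^sub>1 := {u})) p q) (insert e\<^sub>1 J)"
    using reduction[of "{u}"] by auto
  \<comment> \<open>With this \<open>v\<close> the edge row has \<open>- q e\<^sub>1\<close> in the
    columns of \<open>u\<close>, a multiple of the new loop row; the two old loops span the plane at
    \<open>v\<close>.\<close>
  let ?p = "p(v := p u + q e\<^sub>1)" and ?q = "q(e\<^sub>2 := axis 1 1, e\<^sub>3 := axis 2 1)"
  show ?thesis
  proof (rule extension[OF _ indep, of ?p ?q])
    fix c\<^sub>1 c\<^sub>2 c\<^sub>3 assume "c\<^sub>1 *\<^sub>R lc_row En ?p ?q e\<^sub>1 $ v + c\<^sub>2 *\<^sub>R lc_row En ?p ?q e\<^sub>2 $ v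
      + c\<^sub>3 *\<^sub>R lc_row En ?p ?q e\<^sub>3 $ v = 0"
    then have eq: "c\<^sub>1 *\<^sub>R q e\<^sub>1 + c\<^sub>2 *\<^sub>R axis 1 1 + c\<^sub>3 *\<^sub>R axis 2 1 = 0"
      using ends distinct by (simp add: lc_row_edge lc_row_loop)
    have "c\<^sub>2 = 0 \<and> c\<^sub>3 = 0" if "c\<^sub>1 = 0"
      using eq that by (intro cross2_independent[of "axis 1 1" "axis 2 1"]) (simp_all add: cross2_def axis_def)
    moreover have "c\<^sub>1 *\<^sub>R lc_row En ?p ?q e\<^sub>1 + c\<^sub>2 *\<^sub>R lc_row En ?p ?q e\<^sub>2 + c\<^sub>3 *\<^sub>R lc_row En ?p ?q e\<^sub>3
        = (- c\<^sub>1) *\<^sub>R lc_row (En(e\<^sub>1 := {u})) p q e\<^sub>1" (is "?l = ?r")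
    proof -
      have "?l $ w = ?r $ w" for w
        using ends distinct eq by (auto simp: lc_row_edge lc_row_loop)
      then show ?thesis by (simp add: vec_eq_iff)
    qed
    ultimately show "\<exists>k. c\<^sub>1 *\<^sub>R lc_row En ?p ?q e\<^sub>1 + c\<^sub>2 *\<^sub>R lc_row En ?p ?q e\<^sub>2
        + c\<^sub>3 *\<^sub>R lc_row En ?p ?q e\<^sub>3 = k *\<^sub>R lc_row (En(e\<^sub>1 := {u})) p q e\<^sub>1 \<and>
        (k = 0 \<longrightarrow> c\<^sub>1 = 0 \<and> c\<^sub>2 = 0 \<and> c\<^sub>3 = 0)"
      by (intro exI[of _ "- c\<^sub>1"]) simp
  qed (use ends in auto)
qed

lemma realization_edge_edge_loop:
  assumes ends: "En e\<^sub>1 = {v, u}" "u \<noteq> v" "En e\<^sub>2 = {v, w}" "w \<noteq> v" "u \<noteq> w" "En e\<^sub>3 = {v}"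
    and unblocked: "\<not> blocked En J {u}"
  shows "\<exists>p q. indep_family (lc_row En p q) I"
proof -
  obtain p q where generic: "algebraically_independent (coords p q) (coord_index UNIV I)"
    and indep: "indep_family (lc_row (En(e\<^sub>1 := {u})) p q) (insert e\<^sub>1 J)"
    using reduction[OF _ unblocked] by auto
  \<comment> \<open>The old loop takes the direction of the edge \<open>e\<^sub>1\<close>, so these
    two can cancel at \<open>v\<close>, while the edge \<open>e\<^sub>2\<close> is transversal to
    them.\<close>
  let ?p = "p(v := p u + q e\<^sub>1)" and ?q = "q(e\<^sub>3 := q e\<^sub>1)"
  have "cross2 (q e\<^sub>1) (p u - p w) \<noteq> 0"
    using generic_loop_edge_cross2[OF generic] star_in_I ends by simp
  \<comment> \<open>Adding \<open>q e\<^sub>1\<close> to the second vector leaves the determinant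
    unchanged.\<close>
  then have nonzero: "cross2 (q e\<^sub>1) (p u + q e\<^sub>1 - p w) \<noteq> 0"
    by (simp add: cross2_def algebra_simps)
  show ?thesis
  proof (rule extension[OF _ indep, of ?p ?q])
    fix c\<^sub>1 c\<^sub>2 c\<^sub>3 assume "c\<^sub>1 *\<^sub>R lc_row En ?p ?q e\<^sub>1 $ v + c\<^sub>2 *\<^sub>R lc_row En ?p ?q e\<^sub>2 $ v
      + c\<^sub>3 *\<^sub>R lc_row En ?p ?q e\<^sub>3 $ v = 0"
    then have "(c\<^sub>1 + c\<^sub>3) *\<^sub>R q e\<^sub>1 + c\<^sub>2 *\<^sub>R (p u + q e\<^sub>1 - p w) = 0"
      using ends distinct by (simp add: lc_row_edge lc_row_loop algebra_simps)
    then have "c\<^sub>1 + c\<^sub>3 = 0 \<and> c\<^sub>2 = 0"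
      by (rule cross2_independent[OF nonzero])
    then have c: "c\<^sub>3 = - c\<^sub>1" "c\<^sub>2 = 0"
      by simp_all
    moreover have "c\<^sub>1 *\<^sub>R lc_row En ?p ?q e\<^sub>1 + c\<^sub>2 *\<^sub>R lc_row En ?p ?q e\<^sub>2 + c\<^sub>3 *\<^sub>R lc_row En ?p ?q e\<^sub>3
        = (- c\<^sub>1) *\<^sub>R lc_row (En(e\<^sub>1 := {u})) p q e\<^sub>1" (is "?l = ?r")
    proof -
      have "?l $ y = ?r $ y" for y
        using ends distinct c by (auto simp: lc_row_edge lc_row_loop)
      then show ?thesis by (simp add: vec_eq_iff)
    qed
    ultimately show "\<exists>k. c\<^sub>1 *\<^sub>R lc_row En ?p ?q e\<^sub>1 + c\<^sub>2 *\<^sub>R lc_row En ?p ?q e\<^sub>2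
        + c\<^sub>3 *\<^sub>R lc_row En ?p ?q e\<^sub>3 = k *\<^sub>R lc_row (En(e\<^sub>1 := {u})) p q e\<^sub>1 \<and>
        (k = 0 \<longrightarrow> c\<^sub>1 = 0 \<and> c\<^sub>2 = 0 \<and> c\<^sub>3 = 0)"
      by (intro exI[of _ "- c\<^sub>1"]) simp
  qed (use ends in auto)
qed

lemma realization_edge_edge_edge:
  assumes ends: "En e\<^sub>1 = {v, u}" "u \<noteq> v" "En e\<^sub>2 = {v, w}" "w \<noteq> v" "En e\<^sub>3 = {v, x}" "x \<noteq> v"
    "u \<noteq> w" "u \<noteq> x" "w \<noteq> x"
    and unblocked: "\<not> blocked En J {u, w}"
  shows "\<exists>p q. indep_family (lc_row En p q) I"
proof -
  obtain p q where generic: "algebraically_independent (coords p q) (coord_index UNIV I)"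
    and indep: "indep_family (lc_row (En(e\<^sub>1 := {u, w})) p q) (insert e\<^sub>1 J)"
    using reduction[OF _ unblocked] ends by auto
  \<comment> \<open>With \<open>v\<close> at the midpoint, \<open>e\<^sub>1\<close> and
    \<open>e\<^sub>2\<close> are collinear; with equal coefficients they cancel at \<open>v\<close>
    and leave a multiple of the row of the new edge joining \<open>u\<close> and
    \<open>w\<close>.\<close>
  let ?m = "(1/2) *\<^sub>R (p u + p w)"
  let ?p = "p(v := ?m)"
  have "cross2 (p u - p w) (p u - p x) \<noteq> 0"
    using generic_points_cross2[OF generic] ends by simp
  \<comment> \<open>\<open>?m\<close> differs from \<open>p u\<close> by a multiple of
    \<open>p u - p w\<close>.\<close>
  moreover have "cross2 (p u - p w) (?m - p x) = cross2 (p u - p w) (p u - p x)"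
    by (simp add: cross2_def field_simps)
  ultimately have nonzero: "cross2 (p u - p w) (?m - p x) \<noteq> 0"
    by simp
  show ?thesis
  proof (rule extension[OF _ indep, of ?p q])
    fix c\<^sub>1 c\<^sub>2 c\<^sub>3 assume "c\<^sub>1 *\<^sub>R lc_row En ?p q e\<^sub>1 $ v + c\<^sub>2 *\<^sub>R lc_row En ?p q e\<^sub>2 $ v
      + c\<^sub>3 *\<^sub>R lc_row En ?p q e\<^sub>3 $ v = 0"
    then have "c\<^sub>1 *\<^sub>R (?m - p u) + c\<^sub>2 *\<^sub>R (?m - p w) + c\<^sub>3 *\<^sub>R (?m - p x) = 0"
      using ends distinct by (simp add: lc_row_edge)
    moreover have "?m - p u = (- 1/2) *\<^sub>R (p u - p w)" "?m - p w = (1/2) *\<^sub>R (p u - p w)"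
      by (simp_all add: vec_eq_iff field_simps)
    ultimately have "((c\<^sub>2 - c\<^sub>1) / 2) *\<^sub>R (p u - p w) + c\<^sub>3 *\<^sub>R (?m - p x) = 0"
      by (simp add: vec_eq_iff algebra_simps diff_divide_distrib)
    then have "(c\<^sub>2 - c\<^sub>1) / 2 = 0 \<and> c\<^sub>3 = 0"
      by (rule cross2_independent[OF nonzero])
    then have c: "c\<^sub>2 = c\<^sub>1" "c\<^sub>3 = 0"
      by simp_all
    moreover have "c\<^sub>1 *\<^sub>R lc_row En ?p q e\<^sub>1 + c\<^sub>2 *\<^sub>R lc_row En ?p q e\<^sub>2 + c\<^sub>3 *\<^sub>R lc_row En ?p q e\<^sub>3
        = (c\<^sub>1 / 2) *\<^sub>R lc_row (En(e\<^sub>1 := {u, w})) p q e\<^sub>1" (is "?l = ?r")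
    proof -
      have "?l $ y = ?r $ y" for y
        using ends distinct c by (auto simp: lc_row_edge vec_eq_iff field_simps)
      then show ?thesis by (simp add: vec_eq_iff)
    qed
    ultimately show "\<exists>k. c\<^sub>1 *\<^sub>R lc_row En ?p q e\<^sub>1 + c\<^sub>2 *\<^sub>R lc_row En ?p q e\<^sub>2
        + c\<^sub>3 *\<^sub>R lc_row En ?p q e\<^sub>3 = k *\<^sub>R lc_row (En(e\<^sub>1 := {u, w})) p q e\<^sub>1 \<and>
        (k = 0 \<longrightarrow> c\<^sub>1 = 0 \<and> c\<^sub>2 = 0 \<and> c\<^sub>3 = 0)"
      by (intro exI[of _ "c\<^sub>1 / 2"]) simp
  qed (use ends in auto)
qed

text \<open>The two swaps generate all orders of the star, so each case is treated for one order
  only.\<close>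

lemma swap_12: "degree_3_vertex En I v e\<^sub>2 e\<^sub>1 e\<^sub>3"
  using sparse star distinct smaller by unfold_locales (auto simp: insert_commute)

lemma swap_23: "degree_3_vertex En I v e\<^sub>1 e\<^sub>3 e\<^sub>2"
  using sparse star distinct smaller by unfold_locales (auto simp: insert_commute)

lemma realization_two_edges:
  assumes ends: "En e\<^sub>1 = {v, u}" "u \<noteq> v" "En e\<^sub>2 = {v, w}" "w \<noteq> v" "En e\<^sub>3 = {v}"
  shows "\<exists>p q. indep_family (lc_row En p q) I"
proof -
  have "u \<noteq> w"
    using sparse_edges_distinct_ends[OF sparse] star_in_I distinct ends by blast
  \<comment> \<open>Both blockers would be full tight, and so would their union, which spans both
    neighbours; \<open>not_full_tight\<close> excludes this.\<close>
  have "\<not> blocked En J {u} \<or> \<not> blocked En J {w}"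
  proof (rule ccontr)
    assume "\<not> ?thesis"
    then obtain A B where AB: "A \<subseteq> J" "full_tight En A" "u \<in> vset En A"
      "B \<subseteq> J" "full_tight En B" "w \<in> vset En B"
      by (auto simp: blocked_def)
    then have "full_tight En (A \<union> B)"
      by (intro full_tight_Un[OF sparse]) auto
    moreover have "\<not> full_tight En (A \<union> B)"
      using AB ends by (intro not_full_tight) auto
    ultimately show False by blast
  qed
  then show ?thesis
  proof
    assume "\<not> blocked En J {u}"
    then show ?thesis
      using realization_edge_edge_loop[OF ends(1-4) \<open>u \<noteq> w\<close> ends(5)] by blast
  next
    assume "\<not> blocked En J {w}"
    then show ?thesis
      using degree_3_vertex.realization_edge_edge_loop[OF swap_12 ends(3,4,1,2)
          \<open>u \<noteq> w\<close>[symmetric] ends(5)]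
      by (simp add: insert_commute)
  qed
qed

lemma realization_three_edges:
  assumes ends: "En e\<^sub>1 = {v, u}" "u \<noteq> v" "En e\<^sub>2 = {v, w}" "w \<noteq> v" "En e\<^sub>3 = {v, x}" "x \<noteq> v"
  shows "\<exists>p q. indep_family (lc_row En p q) I"
proof -
  have ne: "u \<noteq> w" "u \<noteq> x" "w \<noteq> x"
    using sparse_edges_distinct_ends[OF sparse] star_in_I distinct ends by blast+
  \<comment> \<open>Three blockers would yield one tight set spanning \<open>u\<close>,
    \<open>w\<close> and \<open>x\<close>, but adding the star to a tight set of either kind breaks
    the count.\<close>
  have "\<not> blocked En J {u, w} \<or> \<not> blocked En J {u, x} \<or> \<not> blocked En J {w, x}"
  proof (rule ccontr)
    assume "\<not> ?thesis"
    then have "blocked En J {u, w}" "blocked En J {u, x}" "blocked En J {w, x}"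
      by simp_all
    then obtain A B C where "A \<subseteq> J" "full_tight En A \<or> edge_tight En A" "{u, w} \<subseteq> vset En A"
      and "B \<subseteq> J" "full_tight En B \<or> edge_tight En B" "{u, x} \<subseteq> vset En B"
      and "C \<subseteq> J" "full_tight En C \<or> edge_tight En C" "{w, x} \<subseteq> vset En C"
      by (elim blockedE)
    then have "\<exists>D\<subseteq>J. (full_tight En D \<or> edge_tight En D) \<and> {u, w, x} \<subseteq> vset En D"
      using ne by (intro three_tight_sets[of En J A B C u w x] sparse_subset[OF sparse]) auto
    then obtain D where D: "D \<subseteq> J" "full_tight En D \<or> edge_tight En D" "{u, w, x} \<subseteq> vset En D"
      by (elim exE conjE)
    have "\<not> full_tight En D"
      using D(1,3) ends by (intro not_full_tight) auto
    moreover have "\<not> edge_tight En D"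
      using D(1,3) ends by (intro not_edge_tight) (auto simp: all_edges_def)
    ultimately show False
      using D(2) by blast
  qed
  then consider "\<not> blocked En J {u, w}" | "\<not> blocked En J {u, x}" | "\<not> blocked En J {w, x}"
    by blast
  then show ?thesis
  proof cases
    case 1
    then show ?thesis
      using realization_edge_edge_edge[OF ends ne] by blast
  next
    case 2
    then show ?thesis
      using degree_3_vertex.realization_edge_edge_edge[OF swap_23 ends(1,2,5,6,3,4)] ne
      by (simp add: insert_commute)
  next
    case 3
    have "degree_3_vertex En I v e\<^sub>2 e\<^sub>3 e\<^sub>1"
      by (rule degree_3_vertex.swap_23[OF swap_12])
    from degree_3_vertex.realization_edge_edge_edge[OF this ends(3,4,5,6,1,2)] 3 ne show ?thesis
      by (simp add: insert_commute)
  qed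
qed

lemma realization: "\<exists>p q. indep_family (lc_row En p q) I"
proof -
  interpret s13: degree_3_vertex En I v e\<^sub>3 e\<^sub>2 e\<^sub>1
    by (rule degree_3_vertex.swap_12[OF degree_3_vertex.swap_23[OF swap_12]])
  interpret s12: degree_3_vertex En I v e\<^sub>2 e\<^sub>1 e\<^sub>3 by (rule swap_12)
  interpret s23: degree_3_vertex En I v e\<^sub>1 e\<^sub>3 e\<^sub>2 by (rule swap_23)
  interpret s231: degree_3_vertex En I v e\<^sub>2 e\<^sub>3 e\<^sub>1 by (rule s12.swap_23)
  have loop_or_edge: "En e = {v} \<or> (\<exists>u. En e = {v, u} \<and> u \<noteq> v)" if "e \<in> {e\<^sub>1, e\<^sub>2, e\<^sub>3}" for e
    using that star sparse_card_ends[OF sparse, of e] incident_cases[of En e v] by blast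
  \<comment> \<open>Three loops at \<open>v\<close> would be three elements on one vertex.\<close>
  have "\<not> (En e\<^sub>1 = {v} \<and> En e\<^sub>2 = {v} \<and> En e\<^sub>3 = {v})"
    using not_full_tight[of "{}"] by auto
  moreover have "En e\<^sub>1 = {v} \<or> (\<exists>u. En e\<^sub>1 = {v, u} \<and> u \<noteq> v)"
    "En e\<^sub>2 = {v} \<or> (\<exists>u. En e\<^sub>2 = {v, u} \<and> u \<noteq> v)" "En e\<^sub>3 = {v} \<or> (\<exists>u. En e\<^sub>3 = {v, u} \<and> u \<noteq> v)"
    by (rule loop_or_edge; simp)+
  ultimately show ?thesis
    using realization_edge_loop_loop s12.realization_edge_loop_loop s13.realization_edge_loop_loop
      realization_two_edges s23.realization_two_edges s231.realization_two_edges
      realization_three_edges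
    by metis
qed

end

text \<open>Henneberg induction on the number of elements, with \<open>En\<close> generalized
  because the reduction changes ends.\<close>

lemma count_sparse_imp_realization:
  fixes En :: "'e \<Rightarrow> 'v::finite set"
  assumes "count_sparse En I"
  shows "\<exists>p q. indep_family (lc_row En p q) I"
  using assms
proof (induction "card I" arbitrary: En I rule: less_induct)
  case less
  show ?case
  proof (cases "I = {}")
    case True
    then show ?thesis by (simp add: indep_family_def)
  next
    case False
    then obtain v where v: "v \<in> vset En I" "card {e\<in>I. v \<in> En e} \<le> 3"
      using exists_vertex_of_degree_le_3[OF less.prems] by blast
    define S where "S = {e\<in>I. v \<in> En e}"
    have S: "S \<noteq> {}" "S \<subseteq> I"
      using v(1) by (auto simp: S_def vset_def)
    have fin: "finite I" using less.prems by (rule sparse_finite)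
    show ?thesis
    proof (cases "card S = 3")
      case True
      then obtain e\<^sub>1 e\<^sub>2 e\<^sub>3 where "S = {e\<^sub>1, e\<^sub>2, e\<^sub>3}" "e\<^sub>1 \<noteq> e\<^sub>2" "e\<^sub>1 \<noteq> e\<^sub>3" "e\<^sub>2 \<noteq> e\<^sub>3"
        by (auto simp: card_3_iff)
      then interpret degree_3_vertex En I v e\<^sub>1 e\<^sub>2 e\<^sub>3
        using less by unfold_locales (simp_all add: S_def)
      show ?thesis by (rule realization)
    next
      case False
      have "\<exists>p q. indep_family (lc_row En p q) (I - S)"
        using S fin by (intro less.hyps sparse_subset[OF less.prems] psubset_card_mono) auto
      then show ?thesis
        using False v(2) S(1) realization_degree_le_2[OF less.prems, of S v] by (simp add: S_def)
    qed
  qed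
qed

section \<open>A cover by tight sets\<close>

locale maximal_sparse =
  fixes G :: "('v::finite, 'e) looped_graph" and T J :: "'e set"
  assumes graph: "looped_simple_graph G" and T: "T \<subseteq> edges G \<union> loops G"
    and J: "J \<subseteq> T" and sparse: "count_sparse (ends G) J"
    and maximal: "\<And>e. e \<in> T - J \<Longrightarrow> \<not> count_sparse (ends G) (insert e J)"
begin

abbreviation "En \<equiv> ends G"

lemma card_edge: "e \<in> edges G \<Longrightarrow> card (En e) = 2"
  and card_loop: "e \<in> loops G \<Longrightarrow> card (En e) = 1"
  and edge_not_loop: "e \<in> edges G \<Longrightarrow> e \<notin> loops G"
  using graph by (auto simp: looped_simple_graph_def)

lemma edge_if_card_2: "e \<in> T \<Longrightarrow> card (En e) = 2 \<Longrightarrow> e \<in> edges G"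
  using T card_loop by fastforce

lemma ends_nonempty: "e \<in> T \<Longrightarrow> En e \<noteq> {}"
  using T card_edge card_loop by fastforce

lemma verts_of_eq: "verts_of G A = vset En A"
  by (simp add: verts_of_def vset_def)

lemma finite_J: "finite J"
  using sparse by (rule sparse_finite)

text \<open>Full tight sets are closed under union, so this is the largest one; it yields the block
  \<open>T_0\<close>.\<close>

definition F where "F = \<Union>{A. A \<subseteq> J \<and> full_tight En A}"

lemma F_subset: "F \<subseteq> J"
  by (auto simp: F_def)

lemma full_tight_subset_F: "A \<subseteq> J \<Longrightarrow> full_tight En A \<Longrightarrow> A \<subseteq> F"
  by (auto simp: F_def)

lemma full_tight_F: "full_tight En F"
proof -
  let ?S = "{A. A \<subseteq> J \<and> full_tight En A}"
  have "finite ?S" using finite_J by simp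
  moreover have "{} \<in> ?S" by simp
  ultimately obtain M where M: "M \<in> ?S" "\<forall>A\<in>?S. M \<subseteq> A \<longrightarrow> M = A"
    using finite_has_maximal[of ?S] by blast
  have "A \<subseteq> M" if "A \<in> ?S" for A
  proof -
    have "M \<union> A \<in> ?S"
      using that M(1) full_tight_Un[OF sparse] by simp
    then show ?thesis using M(2) by blast
  qed
  then have "F = M"
    using M(1) unfolding F_def by blast
  then show ?thesis using M(1) by simp
qed

text \<open>Sets inside \<open>F\<close> are left out because the block of \<open>F\<close> absorbs
  them; the others meet \<open>F\<close> in at most one vertex.\<close>

definition "maximal_edge_tight =
  {A. A \<subseteq> J \<and> edge_tight En A \<and> (\<forall>B. B \<subseteq> J \<and> edge_tight En B \<and> A \<subseteq> B \<longrightarrow> A = B) \<and> \<not> A \<subseteq> F}"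

lemma finite_maximal_edge_tight: "finite maximal_edge_tight"
  by (rule finite_subset[of _ "Pow J"]) (auto simp: maximal_edge_tight_def finite_J)

lemma maximal_edge_tightD:
  assumes "A \<in> maximal_edge_tight"
  shows "A \<subseteq> J" "edge_tight En A" "A \<subseteq> edges G" "A \<noteq> {}"
  using assms J edge_if_card_2
  by (auto simp: maximal_edge_tight_def edge_tight_def all_edges_def)

lemma maximal_edge_tight_eq:
  "A \<in> maximal_edge_tight \<Longrightarrow> B \<subseteq> J \<Longrightarrow> edge_tight En B \<Longrightarrow> A \<subseteq> B \<Longrightarrow> A = B"
  by (simp add: maximal_edge_tight_def)

text \<open>A second common vertex would make the union edge tight, against maximality.\<close>

lemma card_maximal_edge_tight_Int:
  assumes "A \<in> maximal_edge_tight" "B \<in> maximal_edge_tight" "A \<noteq> B"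
  shows "card (vset En A \<inter> vset En B) \<le> 1"
proof (rule ccontr)
  assume "\<not> ?thesis"
  then have "edge_tight En (A \<union> B)"
    using maximal_edge_tightD(1,2) assms by (intro edge_tight_Un[OF sparse]) auto
  moreover have "A \<union> B \<subseteq> J"
    using maximal_edge_tightD(1) assms(1,2) by blast
  ultimately have "A = A \<union> B" "B = A \<union> B"
    by (intro maximal_edge_tight_eq[OF assms(1)] maximal_edge_tight_eq[OF assms(2)]; blast)+
  with assms(3) show False by blast
qed

text \<open>A second common vertex would make \<open>F \<union> A\<close> full tight and thus put
  \<open>A\<close> into \<open>F\<close>.\<close>

lemma card_F_maximal_edge_tight_Int:
  assumes "A \<in> maximal_edge_tight"
  shows "card (vset En F \<inter> vset En A) \<le> 1"
proof (rule ccontr)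
  assume "\<not> ?thesis"
  then have "full_tight En (F \<union> A)"
    using maximal_edge_tightD(1,2)[OF assms] F_subset full_tight_F
    by (intro full_tight_Un_edge_tight[OF sparse]) auto
  then have "A \<subseteq> F"
    using full_tight_subset_F[of "F \<union> A"] maximal_edge_tightD(1)[OF assms] F_subset by blast
  with assms show False by (simp add: maximal_edge_tight_def)
qed

text \<open>By maximality of \<open>J\<close> some tight set obstructs adding \<open>e\<close>; a
  full tight obstruction lies inside \<open>F\<close>.\<close>

lemma tight_of_not_in_J:
  assumes "e \<in> T - J"
  shows "En e \<subseteq> vset En F \<or> (card (En e) = 2 \<and> (\<exists>A\<subseteq>J. edge_tight En A \<and> En e \<subseteq> vset En A))"
proof (rule ccontr)
  assume "\<not> ?thesis"
  then have neg: "\<not> En e \<subseteq> vset En F"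
    "\<And>A. A \<subseteq> J \<Longrightarrow> edge_tight En A \<Longrightarrow> card (En e) = 2 \<Longrightarrow> \<not> En e \<subseteq> vset En A"
    by blast+
  have "card (En e) \<in> {1, 2}"
    using assms T card_edge card_loop by auto
  moreover have "\<not> En e \<subseteq> vset En A" if "A \<subseteq> J" "full_tight En A" for A
    using vset_mono[OF full_tight_subset_F[OF that]] neg(1) by (meson subset_trans)
  ultimately have "count_sparse En (insert e J)"
    using neg(2) by (intro sparse_insert[OF sparse])
  with maximal assms show False by blast
qed

text \<open>An edge of \<open>J\<close> is edge tight by itself, \<open>1 + 3 = 4\<close>; any other
  one is spanned by an obstruction. Either set is then enlarged to a maximal one.\<close>

lemma edge_covered:
  assumes "e \<in> T" "e \<in> edges G" "\<not> En e \<subseteq> vset En F"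
  shows "\<exists>A\<in>maximal_edge_tight. En e \<subseteq> vset En A"
proof -
  have "\<exists>A\<subseteq>J. edge_tight En A \<and> En e \<subseteq> vset En A"
  proof (cases "e \<in> J")
    case True
    then show ?thesis
      using card_edge[OF assms(2)]
      by (intro exI[of _ "{e}"]) (simp add: edge_tight_def all_edges_def)
  next
    case False
    then show ?thesis
      using tight_of_not_in_J assms by blast
  qed
  then obtain A where A: "A \<subseteq> J" "edge_tight En A" "En e \<subseteq> vset En A" by blast
  let ?S = "{B. B \<subseteq> J \<and> edge_tight En B \<and> A \<subseteq> B}"
  have "finite ?S" using finite_J by simp
  moreover have "A \<in> ?S" using A by simp
  ultimately obtain M where M: "M \<in> ?S" "\<forall>B\<in>?S. M \<subseteq> B \<longrightarrow> M = B"
    using finite_has_maximal[of ?S] by blast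
  then have sub: "En e \<subseteq> vset En M"
    using A(3) vset_mono[of A M En] by blast
  then have "\<not> M \<subseteq> F"
    using assms(3) vset_mono[of M F En] by blast
  moreover have "M = B" if "B \<subseteq> J" "edge_tight En B" "M \<subseteq> B" for B
    using that M(1) by (intro M(2)[rule_format]) auto
  ultimately have "M \<in> maximal_edge_tight"
    using M(1) unfolding maximal_edge_tight_def by blast
  with sub show ?thesis by blast
qed

text \<open>Serves as \<open>L'\<close> in the formula.\<close>

definition "loose_loops = {l\<in>T \<inter> loops G. \<not> En l \<subseteq> vset En F}"
definition "full_block = {e\<in>T. En e \<subseteq> vset En F}"
definition "block A = {e\<in>T \<inter> edges G. En e \<subseteq> vset En A}"
text \<open>\<open>full_block\<close> serves as \<open>T_0\<close>; it is dropped when empty, as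
  blocks have to be nonempty.\<close>

definition "blocks = ({full_block} - {{}}) \<union> block ` maximal_edge_tight"

text \<open>A loop outside \<open>J\<close> can only be obstructed by a full tight set, so its
  vertex lies in \<open>vset En F\<close>.\<close>

lemma loose_loops_subset: "loose_loops \<subseteq> J"
proof
  fix l assume l: "l \<in> loose_loops"
  then have "card (En l) \<noteq> 2" "l \<in> T" "\<not> En l \<subseteq> vset En F"
    using card_loop by (auto simp: loose_loops_def)
  then show "l \<in> J"
    using tight_of_not_in_J[of l] by blast
qed

section \<open>The blocks as an admissible partition\<close>

lemma vset_full_block: "vset En full_block = vset En F"
  using F_subset J by (auto simp: full_block_def vset_def)

lemma vset_block: "A \<in> maximal_edge_tight \<Longrightarrow> vset En (block A) = vset En A"
  using maximal_edge_tightD[of A] J by (auto simp: block_def vset_def)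

lemma block_nonempty: "A \<in> maximal_edge_tight \<Longrightarrow> block A \<noteq> {}"
  using maximal_edge_tightD[of A] J unfolding block_def vset_def by blast

lemma block_edges: "e \<in> block A \<Longrightarrow> card (En e) = 2"
  by (simp add: block_def card_edge)

lemma full_block_Int_block:
  assumes "A \<in> maximal_edge_tight"
  shows "full_block \<inter> block A = {}"
  using card_F_maximal_edge_tight_Int[OF assms] block_edges
  by (intro Int_empty_of_card_vset_Int_le_1[of En]) (auto simp: vset_full_block vset_block[OF assms])

lemma block_Int_block:
  assumes "A \<in> maximal_edge_tight" "B \<in> maximal_edge_tight" "A \<noteq> B"
  shows "block A \<inter> block B = {}"
  using card_maximal_edge_tight_Int[OF assms] block_edges
  by (intro Int_empty_of_card_vset_Int_le_1[of En]) (auto simp: vset_block assms)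

lemma inj_block: "inj_on block maximal_edge_tight"
proof (rule inj_onI)
  fix A B assume "A \<in> maximal_edge_tight" "B \<in> maximal_edge_tight" "block A = block B"
  then show "A = B"
    using block_Int_block[of A B] block_nonempty[of A] by auto
qed

lemma Union_blocks: "\<Union>blocks = T - loose_loops"
proof
  show "\<Union>blocks \<subseteq> T - loose_loops"
    using edge_not_loop by (auto simp: blocks_def full_block_def block_def loose_loops_def)
  show "T - loose_loops \<subseteq> \<Union>blocks"
  proof
    fix e assume e: "e \<in> T - loose_loops"
    show "e \<in> \<Union>blocks"
    proof (cases "En e \<subseteq> vset En F")
      case True
      then have "e \<in> full_block" using e by (simp add: full_block_def)
      then show ?thesis by (auto simp: blocks_def)
    next
      case False
      then have "e \<in> edges G" using e T by (auto simp: loose_loops_def)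
      then show ?thesis
        using edge_covered[of e] e False by (auto simp: blocks_def block_def)
    qed
  qed
qed

lemma admissible_blocks: "admissible_partition G (T - loose_loops) blocks"
proof -
  have partition: "partition_on (T - loose_loops) blocks"
  proof (rule partition_onI)
    fix B C assume BC: "B \<in> blocks" "C \<in> blocks" "B \<noteq> C"
    show "disjnt B C"
    proof (cases "B = full_block \<or> C = full_block")
      case True
      then show ?thesis
        using BC full_block_Int_block unfolding blocks_def disjnt_def by blast
    next
      case False
      then obtain A A' where "A \<in> maximal_edge_tight" "A' \<in> maximal_edge_tight"
        "B = block A" "C = block A'"
        using BC unfolding blocks_def by blast
      then show ?thesis
        using BC(3) block_Int_block[of A A'] unfolding disjnt_def by blast
    qed
  next
    show "\<Union>blocks = T - loose_loops" by (rule Union_blocks)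
    show "{} \<notin> blocks"
      using block_nonempty unfolding blocks_def by blast
  qed
  have no_loops: "block A \<inter> loops G = {}" for A
    using edge_not_loop by (auto simp: block_def)
  \<comment> \<open>Without \<open>full_block\<close> every block is loopless, so any of them can
    serve as \<open>T_0\<close>.\<close>
  have "blocks = {} \<or> (\<exists>B\<in>blocks. \<forall>C\<in>blocks - {B}. C \<inter> loops G = {})"
  proof (cases "full_block = {}")
    case True
    then have "\<forall>C\<in>blocks. C \<inter> loops G = {}"
      using no_loops unfolding blocks_def by blast
    then show ?thesis by blast
  next
    case False
    then show ?thesis
      using no_loops by (intro disjI2 bexI[of _ full_block]) (auto simp: blocks_def)
  qed
  moreover have "card (vset En B \<inter> vset En C) \<le> 1" if BC: "B \<in> blocks" "C \<in> blocks" "B \<noteq> C" for B C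
  proof (cases "B = full_block \<or> C = full_block")
    case True
    then obtain A where A: "A \<in> maximal_edge_tight"
      "B = full_block \<and> C = block A \<or> C = full_block \<and> B = block A"
      using BC unfolding blocks_def by blast
    then have "vset En B \<inter> vset En C = vset En F \<inter> vset En A"
      using vset_full_block vset_block[OF A(1)] by auto
    then show ?thesis
      using card_F_maximal_edge_tight_Int[OF A(1)] by simp
  next
    case False
    then obtain A A' where A: "A \<in> maximal_edge_tight" "A' \<in> maximal_edge_tight"
      "B = block A" "C = block A'"
      using BC unfolding blocks_def by blast
    then show ?thesis
      using card_maximal_edge_tight_Int[OF A(1,2)] BC(3) by (auto simp: vset_block)
  qed
  ultimately show ?thesis
    using partition unfolding admissible_partition_def verts_of_eq by blast
qed

lemma count_full_block:
  assumes "full_block \<noteq> {}"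
  shows "count_fun G full_block = int (card F)"
proof -
  have "vset En F \<noteq> {}"
    using assms ends_nonempty by (auto simp: full_block_def)
  then have "F \<noteq> {}" by auto
  \<comment> \<open>\<open>count_fun\<close> takes the larger value only if there is a loop; a
    loopless nonempty \<open>F\<close> would violate the bound for edge sets.\<close>
  have "full_block \<inter> loops G \<noteq> {}"
  proof
    assume none: "full_block \<inter> loops G = {}"
    have "F \<subseteq> full_block"
      using F_subset J by (auto simp: full_block_def vset_def)
    then have "all_edges En F"
      using none F_subset J T \<open>F \<noteq> {}\<close> card_edge unfolding all_edges_def by blast
    then have "card F + 3 \<le> 2 * card (vset En F)"
      by (rule sparse_edges_card_le[OF sparse F_subset])
    with full_tight_F show False by (simp add: full_tight_def)
  qed
  then show ?thesis
    using full_tight_F by (simp add: count_fun_def verts_of_eq vset_full_block full_tight_def)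
qed

lemma count_block:
  assumes "A \<in> maximal_edge_tight"
  shows "count_fun G (block A) = int (card A)"
proof -
  have "block A \<inter> loops G = {}"
    using edge_not_loop by (auto simp: block_def)
  then show ?thesis
    using maximal_edge_tightD(2)[OF assms]
    by (simp add: count_fun_def verts_of_eq vset_block[OF assms] edge_tight_def)
qed

lemma sum_blocks:
  "(\<Sum>B\<in>blocks. count_fun G B) = int (card F) + (\<Sum>A\<in>maximal_edge_tight. int (card A))"
proof -
  have disj: "({full_block} - {{}}) \<inter> block ` maximal_edge_tight = {}"
    using full_block_Int_block by blast
  have "(\<Sum>B\<in>{full_block} - {{}}. count_fun G B) = int (card F)"
  proof (cases "full_block = {}")
    \<comment> \<open>The dropped empty block matches \<open>card F = 0\<close>.\<close>
    case True
    then have "F = {}"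
      using F_subset J by (auto simp: full_block_def vset_def)
    with True show ?thesis by simp
  next
    case False
    then show ?thesis by (simp add: count_full_block)
  qed
  moreover have "(\<Sum>B\<in>block ` maximal_edge_tight. count_fun G B)
      = (\<Sum>A\<in>maximal_edge_tight. int (card A))"
    by (simp add: sum.reindex[OF inj_block] count_block)
  ultimately show ?thesis
    unfolding blocks_def using disj finite_maximal_edge_tight by (subst sum.union_disjoint) auto
qed

text \<open>The loose loops, \<open>F\<close> and the maximal edge tight sets are disjoint parts of
  \<open>J\<close>: sharing an edge would mean sharing two vertices, and a loose loop is not spanned
  by \<open>F\<close>.\<close>

lemma card_cover_le: "card loose_loops + card F + (\<Sum>A\<in>maximal_edge_tight. card A) \<le> card J"
proof -
  let ?U = "\<Union>maximal_edge_tight"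
  have edges: "card (En e) = 2" if "A \<in> maximal_edge_tight" "e \<in> A" for A e
    using maximal_edge_tightD(3) card_edge that by blast
  have "card ?U = (\<Sum>A\<in>maximal_edge_tight. card A)"
  proof (rule card_Union_disjoint)
    show "disjoint maximal_edge_tight"
      unfolding pairwise_def disjnt_def
      using Int_empty_of_card_vset_Int_le_1[OF card_maximal_edge_tight_Int] edges by blast
    show "finite A" if "A \<in> maximal_edge_tight" for A
      using maximal_edge_tightD(1)[OF that] finite_J by (rule finite_subset)
  qed
  moreover have "F \<inter> ?U = {}"
    using Int_empty_of_card_vset_Int_le_1[OF card_F_maximal_edge_tight_Int] edges by blast
  moreover have "loose_loops \<inter> (F \<union> ?U) = {}"
    using maximal_edge_tightD(3) edge_not_loop by (auto simp: loose_loops_def vset_def)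
  moreover have sub: "loose_loops \<union> (F \<union> ?U) \<subseteq> J"
    using loose_loops_subset F_subset maximal_edge_tightD(1) by blast
  moreover have "finite loose_loops" "finite F" "finite ?U"
    using sub finite_J by (auto intro: finite_subset)
  ultimately have "card (loose_loops \<union> (F \<union> ?U))
      = card loose_loops + card F + (\<Sum>A\<in>maximal_edge_tight. card A)"
    using card_Un_disjoint[of loose_loops "F \<union> ?U"] card_Un_disjoint[of F ?U] by simp
  with card_mono[OF finite_J sub] show ?thesis by simp
qed

lemma cover:
  "\<exists>L' P. L' \<subseteq> T \<inter> loops G \<and> admissible_partition G (T - L') P \<and>
     int (card L') + (\<Sum>B\<in>P. count_fun G B) \<le> int (card J)"
proof (intro exI conjI)
  show "loose_loops \<subseteq> T \<inter> loops G" by (auto simp: loose_loops_def)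
  show "admissible_partition G (T - loose_loops) blocks" by (rule admissible_blocks)
  have "int (card loose_loops) + (\<Sum>B\<in>blocks. count_fun G B)
      = int (card loose_loops + card F + (\<Sum>A\<in>maximal_edge_tight. card A))"
    by (simp add: sum_blocks)
  then show "int (card loose_loops) + (\<Sum>B\<in>blocks. count_fun G B) \<le> int (card J)"
    using card_cover_le by linarith
qed

end

section \<open>The rank formula\<close>

lemma indep_family_iff_independent:
  fixes r :: "'j \<Rightarrow> 'a::real_vector"
  assumes "finite J"
  shows "indep_family r J \<longleftrightarrow> inj_on r J \<and> independent (r ` J)"
proof (intro iffI conjI)
  assume indep: "indep_family r J"
  show inj: "inj_on r J"
  proof (rule inj_onI, rule ccontr)
    fix j k assume jk: "j \<in> J" "k \<in> J" "r j = r k" "j \<noteq> k"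
    \<comment> \<open>Two indices with the same vector admit the relation with coefficients
      \<open>1\<close> and \<open>-1\<close>.\<close>
    let ?a = "\<lambda>i. of_bool (i = j) - of_bool (i = k) :: real"
    have "(\<Sum>i\<in>J. ?a i *\<^sub>R r i) = (\<Sum>i\<in>{j, k}. ?a i *\<^sub>R r i)"
      using assms jk by (intro sum.mono_neutral_right) auto
    also have "\<dots> = 0" using jk by simp
    finally have "?a j = 0"
      using indep[unfolded indep_family_def, rule_format, of ?a] jk(1) by blast
    with jk(4) show False by simp
  qed
  show "independent (r ` J)"
  proof (rule independent_if_scalars_zero)
    fix f x assume "(\<Sum>x\<in>r ` J. f x *\<^sub>R x) = 0" "x \<in> r ` J"
    then show "f x = 0"
      using indep[unfolded indep_family_def, rule_format, of "\<lambda>j. f (r j)"]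
      by (auto simp: sum.reindex[OF inj])
  qed (use assms in simp)
next
  assume r: "inj_on r J \<and> independent (r ` J)"
  show "indep_family r J"
    unfolding indep_family_def
  proof (intro allI impI ballI)
    fix a j assume a: "(\<Sum>j\<in>J. a j *\<^sub>R r j) = 0" and j: "j \<in> J"
    have "(\<Sum>x\<in>r ` J. a (the_inv_into J r x) *\<^sub>R x) = (\<Sum>j\<in>J. a j *\<^sub>R r j)"
      using r by (subst sum.reindex) (auto simp: the_inv_into_f_f intro!: sum.cong)
    then have "a (the_inv_into J r (r j)) = 0"
      using a r j assms independentD[of "r ` J" "r ` J" "\<lambda>x. a (the_inv_into J r x)" "r j"] by simp
    then show "a j = 0"
      using r j by (simp add: the_inv_into_f_f)
  qed
qed

section \<open>Upper bounds for the rank of sets of rows\<close>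

definition supported_basis :: "'v set \<Rightarrow> (real^2^'v::finite) set" where
  "supported_basis X = (\<lambda>(v, i). axis v (axis i 1)) ` (X \<times> UNIV)"

lemma supported_in_span:
  assumes "\<And>w. w \<notin> X \<Longrightarrow> x $ w = 0"
  shows "x \<in> span (supported_basis X)"
proof -
  have "x = (\<Sum>v\<in>X. \<Sum>i\<in>UNIV. (x $ v $ i) *\<^sub>R axis v (axis i 1))"
  proof -
    have "(\<Sum>v\<in>X. \<Sum>i\<in>UNIV. (x $ v $ i) *\<^sub>R axis v (axis i 1)) $ w $ j = x $ w $ j" for w j
    proof -
      have "(\<Sum>v\<in>X. \<Sum>i\<in>UNIV. (x $ v $ i) *\<^sub>R axis v (axis i 1)) $ w $ j
          = (\<Sum>v\<in>X. \<Sum>i\<in>UNIV. if v = w \<and> i = j then x $ w $ j else 0)"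
        by (auto simp: axis_def intro!: sum.cong)
      also have "\<dots> = (\<Sum>v\<in>X. if v = w then x $ w $ j else 0)"
        by (intro sum.cong refl) (simp add: sum.delta)
      also have "\<dots> = x $ w $ j"
        using assms[of w] by (simp add: sum.delta)
      finally show ?thesis .
    qed
    then show ?thesis by (simp add: vec_eq_iff)
  qed
  also have "\<dots> \<in> span (supported_basis X)"
    by (intro span_sum span_scale span_base) (auto simp: supported_basis_def)
  finally show ?thesis .
qed

lemma dim_supported_le:
  fixes S :: "(real^2^'v::finite) set"
  assumes "\<And>x w. x \<in> S \<Longrightarrow> w \<notin> X \<Longrightarrow> x $ w = 0"
  shows "dim S \<le> 2 * card X"
proof -
  have "dim S \<le> card (supported_basis X)"
    using assms supported_in_span[of X]
    by (intro dim_le_card) (auto simp: supported_basis_def)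
  also have "\<dots> \<le> card (X \<times> (UNIV :: 2 set))"
    unfolding supported_basis_def by (intro card_image_le) simp
  finally show ?thesis by (simp add: card_cartesian_product)
qed

lemma lc_row_supported: "e \<in> U \<Longrightarrow> w \<notin> vset En U \<Longrightarrow> lc_row En p q e $ w = 0"
  by (auto simp: vset_def intro: lc_row_not_incident)

lemma dim_rows_le: "dim (lc_row En p q ` U) \<le> 2 * card (vset En U)"
  by (rule dim_supported_le) (auto simp: lc_row_supported)

text \<open>The indices 0 and 1 are the infinitesimal translations, 2 is the rotation about the origin.\<close>

definition trivial_motion :: "('v \<Rightarrow> real^2) \<Rightarrow> 'v set \<Rightarrow> nat \<Rightarrow> real^2^'v::finite" where
  "trivial_motion p X k = (\<chi> w. if w \<in> X then
     (if k = 0 then axis 1 1 else if k = 1 then axis 2 1 else vector [- (p w $ 2), p w $ 1]) else 0)"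

lemma lc_row_edge_inner:
  assumes "En e = {u, v}" "u \<noteq> v"
  shows "lc_row En p q e \<bullet> x = (p u - p v) \<bullet> (x $ u - x $ v)"
proof -
  have "lc_row En p q e \<bullet> x = (\<Sum>w\<in>UNIV. lc_row En p q e $ w \<bullet> x $ w)"
    by (simp add: inner_vec_def)
  also have "\<dots> = (\<Sum>w\<in>{u, v}. lc_row En p q e $ w \<bullet> x $ w)"
    using assms by (intro sum.mono_neutral_right) (auto simp: lc_row_not_incident)
  also have "\<dots> = (p u - p v) \<bullet> (x $ u - x $ v)"
    using assms by (simp add: lc_row_edge algebra_simps inner_diff_left inner_diff_right)
  finally show ?thesis .
qed

text \<open>Translations cancel in the difference of the two ends, and the rotation moves the ends
  relative to each other perpendicularly to the edge.\<close>

lemma lc_row_trivial_motion: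
  assumes "En e \<subseteq> X" "card (En e) = 2"
  shows "lc_row En p q e \<bullet> trivial_motion p X k = 0"
proof -
  obtain u v where uv: "En e = {u, v}" "u \<noteq> v"
    using assms(2) by (auto simp: card_2_iff)
  then have "u \<in> X" "v \<in> X" using assms(1) by auto
  then show ?thesis
    unfolding lc_row_edge_inner[of En e u v, OF uv]
    by (simp add: trivial_motion_def inner_vec_def sum_2 algebra_simps)
qed

lemma dim_trivial_motions:
  assumes "u \<in> X" "v \<in> X" "p u \<noteq> p v"
  shows "dim (trivial_motion p X ` {0, 1, 2}) = 3"
proof -
  have "indep_family (trivial_motion p X) {0, 1, 2}"
    unfolding indep_family_def
  proof (intro allI impI)
    fix a :: "nat \<Rightarrow> real" assume "(\<Sum>k\<in>{0, 1, 2}. a k *\<^sub>R trivial_motion p X k) = 0"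
    then have eq: "a 0 *\<^sub>R trivial_motion p X 0
        + (a 1 *\<^sub>R trivial_motion p X 1 + a 2 *\<^sub>R trivial_motion p X 2) = 0"
      by simp
    \<comment> \<open>The columns of \<open>w\<close> express \<open>a 0\<close> and
      \<open>a 1\<close> by \<open>a 2\<close> and \<open>p w\<close>; comparing two distinct points
      then forces \<open>a 2 = 0\<close>.\<close>
    have w: "a 0 = a 2 * p w $ 2" "a 1 = - a 2 * p w $ 1" if "w \<in> X" for w
    proof -
      have "(a 0 *\<^sub>R trivial_motion p X 0
        + (a 1 *\<^sub>R trivial_motion p X 1 + a 2 *\<^sub>R trivial_motion p X 2)) $ w $ i = 0" for i
        by (simp only: eq zero_index)
      from this[of 1] this[of 2] that show "a 0 = a 2 * p w $ 2" "a 1 = - a 2 * p w $ 1"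
        by (simp_all add: trivial_motion_def axis_def)
    qed
    have "a 2 * (p u $ i - p v $ i) = 0" for i
      using w[OF assms(1)] w[OF assms(2)] exhaust_2[of i] by (auto simp: algebra_simps)
    then have "a 2 = 0"
      using assms(3) by (auto simp: vec_eq_iff)
    with w[OF assms(1)] show "\<forall>k\<in>{0, 1, 2}. a k = 0" by simp
  qed
  then show ?thesis
    by (subst (asm) indep_family_iff_independent)
      (auto simp: dim_eq_card_independent card_image)
qed

text \<open>Rows and trivial motions are orthogonal inside a space of dimension
  \<open>2 * card (vset En U)\<close>; the motions take up \<open>3\<close> of it, since an edge
  provides two distinct points.\<close>

lemma dim_edge_rows_le:
  fixes En :: "'e \<Rightarrow> 'v::finite set"
  assumes edges: "all_edges En U" and p: "inj_on p (vset En U)"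
  shows "dim (lc_row En p q ` U) + 3 \<le> 2 * card (vset En U)"
proof -
  let ?M = "trivial_motion p (vset En U) ` {0, 1, 2}"
  obtain e where e: "e \<in> U" "card (En e) = 2"
    using edges by (auto simp: all_edges_def)
  then obtain u v where uv: "En e = {u, v}" "u \<noteq> v"
    by (auto simp: card_2_iff)
  then have "u \<in> vset En U" "v \<in> vset En U"
    using e(1) by (auto simp: vset_def)
  moreover from this have "p u \<noteq> p v"
    using p uv(2) by (auto dest: inj_onD)
  ultimately have "dim ?M = 3"
    by (rule dim_trivial_motions)
  moreover have "dim (lc_row En p q ` U \<union> ?M) = dim (lc_row En p q ` U) + dim ?M"
  proof (rule dim_orthogonal_sum)
    fix x y assume "x \<in> lc_row En p q ` U" "y \<in> ?M"
    then obtain f k where f: "f \<in> U" "x = lc_row En p q f" "y = trivial_motion p (vset En U) k"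
      by blast
    then show "x \<bullet> y = 0"
      using edges by (auto simp: all_edges_def vset_def intro!: lc_row_trivial_motion)
  qed
  moreover have "dim (lc_row En p q ` U \<union> ?M) \<le> 2 * card (vset En U)"
    by (rule dim_supported_le) (auto simp: lc_row_supported trivial_motion_def)
  ultimately show ?thesis by simp
qed

lemma dim_Un_le: "dim (A \<union> B) \<le> dim A + dim (B :: 'a::euclidean_space set)"
proof -
  obtain A' where A': "A' \<subseteq> A" "independent A'" "A \<subseteq> span A'" "card A' = dim A"
    by (rule basis_exists)
  obtain B' where B': "B' \<subseteq> B" "independent B'" "B \<subseteq> span B'" "card B' = dim B"
    by (rule basis_exists)
  have "A \<union> B \<subseteq> span (A' \<union> B')"
    using A'(3) B'(3) span_mono[of A' "A' \<union> B'"] span_mono[of B' "A' \<union> B'"] by blast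
  then have "dim (A \<union> B) \<le> card (A' \<union> B')"
    using A'(2) B'(2) by (intro dim_le_card) (auto intro: independent_imp_finite)
  also have "\<dots> \<le> card A' + card B'" by (rule card_Un_le)
  finally show ?thesis by (simp add: A'(4) B'(4))
qed

lemma dim_UN_le:
  fixes A :: "'i \<Rightarrow> 'a::euclidean_space set"
  assumes "finite I"
  shows "dim (\<Union>i\<in>I. A i) \<le> (\<Sum>i\<in>I. dim (A i))"
  using assms
proof (induction I rule: finite_induct)
  case (insert i I)
  then show ?case
    using dim_Un_le[of "A i" "\<Union>i\<in>I. A i"] by simp
qed simp

section \<open>The two inequalities for generic placements\<close>

context
  fixes G :: "('v::finite, 'e) looped_graph"
  assumes graph: "looped_simple_graph G"
begin

text \<open>Edges are determined by their ends, which are sets over a finite type.\<close>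

lemma finite_edges_loops: "finite (edges G \<union> loops G)"
proof -
  have "finite (ends G ` edges G)" by (rule finite_subset[OF subset_UNIV]) simp
  then show ?thesis
    using graph finite_imageD[of "ends G" "edges G"] by (simp add: looped_simple_graph_def)
qed

lemma rigidity_row_eq_lc_row:
  assumes "e \<in> edges G \<union> loops G"
  shows "rigidity_row G p q e = lc_row (ends G) p q e"
proof -
  have "e \<in> edges G \<longleftrightarrow> card (ends G e) = 2"
    using graph assms by (fastforce simp: looped_simple_graph_def)
  then show ?thesis by (simp add: rigidity_row_def lc_row_def cong: if_cong)
qed

lemma generic_iff:
  "generic G p q \<longleftrightarrow> algebraically_independent (coords p q) (coord_index (verts G) (loops G))"
  by (simp add: generic_def coords_def)

lemma ends_subset: "A \<subseteq> edges G \<union> loops G \<Longrightarrow> vset (ends G) A \<subseteq> verts G"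
  using graph unfolding looped_simple_graph_def vset_def by blast

lemma dim_rows_le_count_fun:
  assumes "generic G p q" "B \<subseteq> edges G \<union> loops G" "B \<noteq> {}"
  shows "int (dim (lc_row (ends G) p q ` B)) \<le> count_fun G B"
proof (cases "B \<inter> loops G = {}")
  case True
  then have "all_edges (ends G) B"
    using assms(2,3) graph unfolding all_edges_def looped_simple_graph_def by blast
  moreover have "inj_on p (vset (ends G) B)"
    using generic_points_distinct[of p q "verts G" "loops G"] assms(1) ends_subset[OF assms(2)]
    unfolding generic_iff inj_on_def by blast
  ultimately have "dim (lc_row (ends G) p q ` B) + 3 \<le> 2 * card (vset (ends G) B)"
    by (rule dim_edge_rows_le)
  with True show ?thesis by (simp add: count_fun_def verts_of_def vset_def)
next
  case False
  then show ?thesis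
    using dim_rows_le[of "ends G" p q B] by (simp add: count_fun_def verts_of_def vset_def)
qed

text \<open>Subadditivity of \<open>dim\<close>: each element of \<open>L'\<close> contributes at
  most one, each block at most its count.\<close>

lemma row_rank_le:
  assumes "generic G p q" "T \<subseteq> edges G \<union> loops G" "L' \<subseteq> T" "partition_on (T - L') P"
  shows "int (row_rank G p q T) \<le> int (card L') + (\<Sum>B\<in>P. count_fun G B)"
proof -
  let ?r = "lc_row (ends G) p q"
  have fin: "finite T"
    using assms(2) finite_edges_loops by (rule finite_subset)
  then have finP: "finite P"
    using assms(4) by (meson finite_Diff finite_elements)
  have T: "T = L' \<union> \<Union>P"
    using assms(3) partition_onD1[OF assms(4)] by blast
  have "rigidity_row G p q ` T = ?r ` T"
    using assms(2) rigidity_row_eq_lc_row by (intro image_cong) auto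
  also have "\<dots> = ?r ` L' \<union> (\<Union>B\<in>P. ?r ` B)"
    by (subst T) blast
  finally have "row_rank G p q T \<le> dim (?r ` L') + dim (\<Union>B\<in>P. ?r ` B)"
    unfolding row_rank_def using dim_Un_le by metis
  also have "dim (?r ` L') \<le> card L'"
    using finite_subset[OF assms(3) fin] dim_le_card[of "?r ` L'" "?r ` L'"] span_superset
      card_image_le[of L' ?r] by fastforce
  also have "dim (\<Union>B\<in>P. ?r ` B) \<le> (\<Sum>B\<in>P. dim (?r ` B))"
    by (rule dim_UN_le[OF finP])
  finally have "int (row_rank G p q T) \<le> int (card L') + (\<Sum>B\<in>P. int (dim (?r ` B)))"
    by (simp flip: of_nat_sum of_nat_add)
  also have "(\<Sum>B\<in>P. int (dim (?r ` B))) \<le> (\<Sum>B\<in>P. count_fun G B)"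
  proof (rule sum_mono)
    fix B assume "B \<in> P"
    then show "int (dim (?r ` B)) \<le> count_fun G B"
      using assms(2) T partition_onD3[OF assms(4)]
      by (intro dim_rows_le_count_fun[OF assms(1)]) auto
  qed
  finally show ?thesis by simp
qed

text \<open>Some placement makes the rows of \<open>J\<close> independent by the Henneberg
  induction, hence the generic \<open>(p, q)\<close> does so too.\<close>

lemma card_sparse_le_row_rank:
  assumes "generic G p q" "T \<subseteq> edges G \<union> loops G" "J \<subseteq> T" "count_sparse (ends G) J"
  shows "card J \<le> row_rank G p q T"
proof -
  let ?r = "lc_row (ends G) p q"
  have fin: "finite J" using assms(4) by (rule sparse_finite)
  obtain p' q' where "indep_family (lc_row (ends G) p' q') J"
    using count_sparse_imp_realization[OF assms(4)] by blast
  then have "indep_family ?r J"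
  proof (rule indep_family_generic[OF fin, rotated])
    show "algebraically_independent (coords p q) (coord_index (verts G) (loops G))"
      using assms(1) by (simp add: generic_iff)
    fix e assume "e \<in> J"
    then show "ends G e \<subseteq> verts G \<and> card (ends G e) \<in> {1, 2} \<and> (card (ends G e) = 1 \<longrightarrow> e \<in> loops G)"
      using assms(2,3) graph by (fastforce simp: looped_simple_graph_def)
  qed
  then have "inj_on ?r J" "independent (?r ` J)"
    using indep_family_iff_independent[OF fin] by blast+
  then have "card J \<le> dim (?r ` T)"
    using assms(3) independent_card_le_dim[of "?r ` J" "?r ` T"] by (simp add: card_image image_mono)
  also have "?r ` T = rigidity_row G p q ` T"
    using assms(2) rigidity_row_eq_lc_row by (intro image_cong) auto
  finally show ?thesis by (simp add: row_rank_def)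
qed

lemma exists_maximal_sparse:
  assumes "T \<subseteq> edges G \<union> loops G"
  shows "\<exists>J. maximal_sparse G T J"
proof -
  let ?S = "{J. J \<subseteq> T \<and> count_sparse (ends G) J}"
  have "finite ?S"
    using finite_subset[OF assms finite_edges_loops] by simp
  moreover have "{} \<in> ?S"
    by (simp add: count_sparse_def all_edges_def)
  ultimately obtain J where J: "J \<in> ?S" "\<forall>K\<in>?S. J \<subseteq> K \<longrightarrow> J = K"
    using finite_has_maximal[of ?S] by blast
  have "\<not> count_sparse (ends G) (insert e J)" if "e \<in> T - J" for e
    using that J(1) J(2)[rule_format, of "insert e J"] by auto
  with J(1) graph assms have "maximal_sparse G T J"
    by unfold_locales auto
  then show ?thesis ..
qed

lemma row_rank_generic:
  assumes "T \<subseteq> edges G \<union> loops G" "generic G p q"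
  shows "int (row_rank G p q T) =
    Min {int (card L') + (\<Sum>B\<in>P. count_fun G B) | L' P.
           L' \<subseteq> T \<inter> loops G \<and> admissible_partition G (T - L') P}" (is "_ = Min ?S")
proof (rule Min_eqI[symmetric])
  have fin: "finite T"
    using assms(1) finite_edges_loops by (rule finite_subset)
  \<comment> \<open>Finiteness for \<open>Min\<close>: each value comes from a subset of
    \<open>T\<close> and a family of subsets of \<open>T\<close>.\<close>
  have "?S \<subseteq> (\<lambda>(L', P). int (card L') + (\<Sum>B\<in>P. count_fun G B)) ` (Pow T \<times> Pow (Pow T))"
  proof
    fix y assume "y \<in> ?S"
    then obtain L' P where y: "y = int (card L') + (\<Sum>B\<in>P. count_fun G B)" "L' \<subseteq> T"
      "partition_on (T - L') P"
      by (auto simp: admissible_partition_def)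
    then have "P \<subseteq> Pow T"
      using partition_onD1 by blast
    with y show "y \<in> (\<lambda>(L', P). int (card L') + (\<Sum>B\<in>P. count_fun G B)) ` (Pow T \<times> Pow (Pow T))"
      by (intro image_eqI[of _ _ "(L', P)"]) auto
  qed
  then show "finite ?S"
    by (rule finite_subset) (simp add: fin)
  show lower: "int (row_rank G p q T) \<le> y" if "y \<in> ?S" for y
    using that row_rank_le[OF assms(2,1)] by (auto simp: admissible_partition_def)
  \<comment> \<open>The cover of a maximal sparse \<open>J\<close> has value at most
    \<open>card J\<close>, hence at most the rank, and so attains the lower bound.\<close>
  obtain J where J: "maximal_sparse G T J"
    using exists_maximal_sparse[OF assms(1)] by blast
  obtain L' P where LP: "L' \<subseteq> T \<inter> loops G" "admissible_partition G (T - L') P"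
    and le: "int (card L') + (\<Sum>B\<in>P. count_fun G B) \<le> int (card J)"
    using maximal_sparse.cover[OF J] by blast
  have "card J \<le> row_rank G p q T"
    using card_sparse_le_row_rank[OF assms(2,1)] maximal_sparse.J[OF J] maximal_sparse.sparse[OF J]
    by blast
  moreover have "int (card L') + (\<Sum>B\<in>P. count_fun G B) \<in> ?S"
    using LP by blast
  ultimately show "int (row_rank G p q T) \<in> ?S"
    using le lower by (metis (mono_tags, lifting) order_antisym of_nat_mono order_trans)
qed

lemma generic_placement_exists: "\<exists>p q. generic G p q"
  using graph generic_exists[of "verts G" "loops G"]
  by (simp add: generic_iff looped_simple_graph_def)

end

theorem theorem2p5:
  fixes G :: "('v::finite, 'e) looped_graph" and T :: "'e set"
  assumes "looped_simple_graph G" and "T \<subseteq> edges G \<union> loops G"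
  shows "int (rank_lc G T) =
    Min {int (card L') + (\<Sum>B\<in>P. count_fun G B) | L' P.
           L' \<subseteq> T \<inter> loops G \<and> admissible_partition G (T - L') P}"
proof -
  note rank = row_rank_generic[OF assms]
  obtain p q where pq: "generic G p q"
    using generic_placement_exists[OF assms(1)] by blast
  \<comment> \<open>The minimum does not mention the placement, so all generic placements have the
    same rank; as one exists, the description in \<open>rank_lc\<close> determines a unique
    value.\<close>
  have "rank_lc G T = row_rank G p q T"
    unfolding rank_lc_def
  proof (rule the_equality)
    show "\<forall>p' q'. generic G p' q' \<longrightarrow> row_rank G p' q' T = row_rank G p q T"
    proof (intro allI impI)
      fix p' q' assume "generic G p' q'"
      then have "int (row_rank G p' q' T) = int (row_rank G p q T)"
        by (rule trans[OF rank rank[OF pq, symmetric]])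
      then show "row_rank G p' q' T = row_rank G p q T" by simp
    qed
  qed (use pq in blast)
  then show ?thesis
    using rank[OF pq] by simp
qed

end
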